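(* Let $\mathcal{X}$ be an ellipse in the Euclidean plane. Let $a,b,c,d$ be four distinct tangents to $\mathcal{X}$, and let $P=a\wedge b$, $Q=c\wedge d$; $S=a\wedge c$, $T=b\wedge d$; $U=b\wedge c$, $V=a\wedge d$ be the three pairs of intersections. Then the following statements are equivalent. (i) $a,b,c,d$ are tangent to a circle $\mathcal{C}$. (ii) $P,Q$ lie on a conic $\mathcal{R}$ confocal to $\mathcal{X}$. (iii) $S,T$ lie on a conic $\mathcal{G}$ confocal to $\mathcal{X}$. (iv) $U,V$ lie on a conic $\mathcal{B}$ confocal to $\mathcal{X}$.
   Context: For two lines $a,b$, the symbol $a\wedge b$ denotes their point of intersection. Two conics are confocal if they have the same foci. Projectively: over the complex projective plane with absolute circle points $\mathsf{I}=(1,i,0)$, $\mathsf{J}=(1,-i,0)$, the foci of a conic (neither degenerate nor a circle) are the four intersections, other than $\mathsf{I},\mathsf{J}$ themselves, of the four tangents from $\mathsf{I}$ and $\mathsf{J}$ to the conic, and two conics share the same foci if these tangents are identical. The conics $\mathcal{R},\mathcal{G},\mathcal{B}$ may be ellipses or hyperbolas.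
   Formalization: Added: the pairs P,Q; S,T; U,V are either all or none contained in a common axis of the ellipse or the line at infinity. This excludes non-rhombic kites and isosceles trapezoids symmetric in an axis, and non-rhombic parallelograms, where the equivalence fails. X is not a circle. *)

theory Defs
  imports "HOL-Analysis.Analysis"
begin

(* Points and lines of the projective plane are nonzero vectors of K^3 up to scaling, and the point
   p lies on the line l iff scalar_product l p = 0; two real vectors represent the same line iff their
   spans agree.  A conic is given by a symmetric matrix.  The Euclidean plane is the set of real points
   with p $ 3 \<noteq> 0, with affine coordinates p $ 1 / p $ 3 and p $ 2 / p $ 3; the line at infinity
   is p $ 3 = 0.  The meet of the lines a and b is cross3 a b, a point at infinity if a and b are
   parallel. *)

definition on_conic :: "'a::field ^ 3 ^ 3 \<Rightarrow> 'a ^ 3 \<Rightarrow> bool" where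
  "on_conic A p \<longleftrightarrow> p \<noteq> 0 \<and> scalar_product p (A *v p) = 0"

(* The tangent at the point p of a nondegenerate conic is the polar A p.  No scalar factor is
   needed: c (A p) = A (c p). *)
definition tangent_to :: "'a::field ^ 3 \<Rightarrow> 'a ^ 3 ^ 3 \<Rightarrow> bool" where
  "tangent_to l A \<longleftrightarrow> (\<exists>p. on_conic A p \<and> l = A *v p)"

(* Existence of a real point excludes the imaginary conics (definite matrices). *)
definition real_conic :: "real ^ 3 ^ 3 \<Rightarrow> bool" where
  "real_conic A \<longleftrightarrow> transpose A = A \<and> det A \<noteq> 0 \<and> (\<exists>p. on_conic A p)"

definition ellipse :: "real ^ 3 ^ 3 \<Rightarrow> bool" where
  "ellipse A \<longleftrightarrow> real_conic A \<and> (\<forall>p. on_conic A p \<longrightarrow> p $ 3 \<noteq> 0)"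

abbreviation complexify :: "real ^ 3 ^ 3 \<Rightarrow> complex ^ 3 ^ 3" where
  "complexify \<equiv> map_matrix complex_of_real"

definition circle_pt_I :: "complex ^ 3" where
  "circle_pt_I = vector [1, \<i>, 0]"

definition circle_pt_J :: "complex ^ 3" where
  "circle_pt_J = vector [1, - \<i>, 0]"

definition circle :: "real ^ 3 ^ 3 \<Rightarrow> bool" where
  "circle A \<longleftrightarrow> real_conic A \<and>
     on_conic (complexify A) circle_pt_I \<and> on_conic (complexify A) circle_pt_J"

(* The foci are the intersections of these tangents (of those from I with those from J). *)
definition isotropic_tangents :: "real ^ 3 ^ 3 \<Rightarrow> (complex ^ 3) set" where
  "isotropic_tangents A = {l. tangent_to l (complexify A) \<and>
     (scalar_product l circle_pt_I = 0 \<or> scalar_product l circle_pt_J = 0)}"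

definition confocal :: "real ^ 3 ^ 3 \<Rightarrow> real ^ 3 ^ 3 \<Rightarrow> bool" where
  "confocal A B \<longleftrightarrow> \<not> circle A \<and> \<not> circle B \<and> isotropic_tangents A = isotropic_tangents B"

(* A principal axis of an ellipse: the polar of a point n at infinity, provided that this polar is
   perpendicular to the direction n. *)
definition principal_axis :: "real ^ 3 ^ 3 \<Rightarrow> real ^ 3 \<Rightarrow> bool" where
  "principal_axis A l \<longleftrightarrow>
     (\<exists>n. n \<noteq> 0 \<and> n $ 3 = 0 \<and> l = A *v n \<and> l $ 1 * n $ 2 = l $ 2 * n $ 1)"

(* The two principal axes of X and the line at infinity are the lines that carry the degenerate
   members of the confocal family of X.  If the opposite vertices P and Q of a quadrilateral
   circumscribed to X both lie on one of these lines, then the quadrilateral is symmetric with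
   respect to that axis, or is a parallelogram. *)
definition exceptional_pair :: "real ^ 3 ^ 3 \<Rightarrow> real ^ 3 \<Rightarrow> real ^ 3 \<Rightarrow> bool" where
  "exceptional_pair X P Q \<longleftrightarrow> (P $ 3 = 0 \<and> Q $ 3 = 0) \<or>
     (\<exists>l. principal_axis X l \<and> scalar_product l P = 0 \<and> scalar_product l Q = 0)"

end

(* Everything happens in the dual plane.  With M the dual conic of X and K = diag(1, 1, 0) the dual
   of the absolute points, the conics confocal to X are the duals of the members M + t K of a pencil.
   A line l is lifted to (l, w) in four-space with w^2 = K(l, l).  All tangents of X then satisfy
   M(l, l) + t (K(l, l) - w^2) = 0 for every t.  The meet of a and b lies on the confocal conic t
   iff, for suitable signs of w, the lifts of a and b are conjugate for the form with parameter t,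
   and a, b, c, d touch a common circle iff, for suitable signs, their four lifts are linearly
   dependent.  Evaluating the forms on a linear relation, split as two terms against two, shows
   that the two conditions agree; the degenerate cases that this leaves are exactly the exceptional
   pairs.  If all three pairs are exceptional, the quadrilateral is a rhombus, a = b + c + d after
   scaling, and all four statements hold. *)

theory Submission
  imports Defs
begin

section \<open>Adjugates and dual conics\<close>

text \<open>A lift (l, w) is an oriented line: \<open>p \<bullet> l = q * w\<close> says that it
  touches the oriented circle with homogeneous centre \<open>p\<close> and radius
  \<open>q / p$3\<close>. A common circle is therefore a linear functional on four-space that kills
  all four lifts, which is why linear dependence is the right condition. Two degenerations obstruct
  the equivalence. A functional with \<open>p$3 = 0\<close> gives no circle; it forces the four
  lines to form two pairs of parallels, hence an exceptional pair at infinity. A parameter with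
  singular M + t K gives no conic; both points then lie on the kernel line, which is an axis. The
  relation is split two against two because its defect for K is then a difference of two squares:
  when it vanishes, only a common sign of the lifts of \<open>c\<close> and \<open>d\<close> remains
  open, and both can be flipped.\<close>

definition bform :: "'a::comm_ring_1 ^ 3 ^ 3 \<Rightarrow> 'a ^ 3 \<Rightarrow> 'a ^ 3 \<Rightarrow> 'a" where
  "bform A x y = scalar_product x (A *v y)"

definition adj3 :: "'a::comm_ring_1 ^ 3 ^ 3 \<Rightarrow> 'a ^ 3 ^ 3" where
  "adj3 A = vector
    [vector [A$2$2 * A$3$3 - A$2$3 * A$3$2, A$1$3 * A$3$2 - A$1$2 * A$3$3, A$1$2 * A$2$3 - A$1$3 * A$2$2],
     vector [A$2$3 * A$3$1 - A$2$1 * A$3$3, A$1$1 * A$3$3 - A$1$3 * A$3$1, A$1$3 * A$2$1 - A$1$1 * A$2$3],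
     vector [A$2$1 * A$3$2 - A$2$2 * A$3$1, A$1$2 * A$3$1 - A$1$1 * A$3$2, A$1$1 * A$2$2 - A$1$2 * A$2$1]]"

lemmas coords3 = vec_eq_iff forall_3 sum_3 scalar_product_def matrix_vector_mult_def

lemma sym3:
  fixes A :: "'a ^ 3 ^ 3"
  shows "transpose A = A \<longleftrightarrow> A$2$1 = A$1$2 \<and> A$3$1 = A$1$3 \<and> A$3$2 = A$2$3"
  by (auto simp: transpose_def vec_eq_iff forall_3)

lemma matrix_vector_adj3: "A *v (adj3 A *v x) = det A *s x"
  by (simp add: coords3 adj3_def det_3 algebra_simps)

lemma adj3_matrix_vector: "adj3 A *v (A *v x) = det A *s x"
  by (simp add: coords3 adj3_def det_3 algebra_simps)

lemma adj3_adj3: "adj3 (adj3 A) $ i $ j = det A * A $ i $ j"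
proof -
  have "\<forall>i j. adj3 (adj3 A) $ i $ j = det A * A $ i $ j"
    by (simp add: forall_3 adj3_def det_3 algebra_simps)
  thus ?thesis by blast
qed

lemma det_adj3: "det (adj3 A) = det A ^ 2"
  by (simp add: adj3_def det_3 power2_eq_square algebra_simps)

lemma transpose_adj3: "transpose A = A \<Longrightarrow> transpose (adj3 A) = adj3 A"
  by (simp add: sym3 adj3_def algebra_simps)

lemma bform_coords: "bform A x y =
    x$1 * (A$1$1 * y$1 + A$1$2 * y$2 + A$1$3 * y$3) +
    x$2 * (A$2$1 * y$1 + A$2$2 * y$2 + A$2$3 * y$3) +
    x$3 * (A$3$1 * y$1 + A$3$2 * y$2 + A$3$3 * y$3)"
  by (simp add: bform_def coords3)

lemma bform_sym: "transpose A = A \<Longrightarrow> bform A x y = bform A y x"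
  by (simp add: sym3 bform_coords algebra_simps)

lemma bform_add_right: "bform A x (y + z) = bform A x y + bform A x z"
  and bform_diff_right: "bform A x (y - z) = bform A x y - bform A x z"
  and bform_scale_right: "bform A x (k *s y) = k * bform A x y"
  and bform_add_left: "bform A (x + y) z = bform A x z + bform A y z"
  and bform_diff_left: "bform A (x - y) z = bform A x z - bform A y z"
  and bform_scale_left: "bform A (k *s x) z = k * bform A x z"
  by (simp_all add: bform_coords algebra_simps)

lemmas bform_linear = bform_add_right bform_diff_right bform_scale_right
  bform_add_left bform_diff_left bform_scale_left

lemma on_conic_bform: "on_conic A p \<longleftrightarrow> p \<noteq> 0 \<and> bform A p p = 0"
  by (simp add: on_conic_def bform_def)

text \<open>Inverting \<open>l = A *v p\<close> recovers the contact point as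
  \<open>adj3 A *v l\<close> divided by \<open>det A\<close>, and the equation of the conic at
  \<open>p\<close> becomes the dual equation at \<open>l\<close>.\<close>

lemma tangent_to_iff:
  fixes A :: "'a::field ^ 3 ^ 3"
  assumes "transpose A = A" "det A \<noteq> 0"
  shows "tangent_to l A \<longleftrightarrow> l \<noteq> 0 \<and> bform (adj3 A) l l = 0"
proof
  assume "tangent_to l A"
  then obtain p where p: "p \<noteq> 0" "scalar_product p (A *v p) = 0" "l = A *v p"
    by (auto simp: tangent_to_def on_conic_def)
  have "adj3 A *v l = det A *s p"
    by (simp add: p adj3_matrix_vector)
  moreover from this have "l \<noteq> 0"
    using p(1) assms(2) by auto
  moreover have "scalar_product l (det A *s p) = det A * scalar_product p (A *v p)"
    by (simp add: p(3) scalar_product_def sum_3 algebra_simps)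
  ultimately show "l \<noteq> 0 \<and> bform (adj3 A) l l = 0"
    using p(2) by (simp add: bform_def)
next
  assume l: "l \<noteq> 0 \<and> bform (adj3 A) l l = 0"
  define p where "p = (1 / det A) *s (adj3 A *v l)"
  have Ap: "A *v p = l"
    using assms(2) by (simp add: p_def vector_scalar_commute[symmetric] matrix_vector_adj3)
  moreover have "p \<noteq> 0"
    using l Ap by auto
  moreover have "scalar_product p l = 1 / det A * bform (adj3 A) l l"
    by (simp add: p_def bform_def) (simp add: coords3 algebra_simps add_divide_distrib)
  ultimately show "tangent_to l A"
    using l unfolding tangent_to_def on_conic_def by force
qed

lemma adj3_complexify: "adj3 (complexify A) = complexify (adj3 A)"
  by (simp add: vec_eq_iff forall_3 adj3_def)

lemma det_complexify: "det (complexify A) = complex_of_real (det A)"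
  by (simp add: det_3)

lemma transpose_complexify: "transpose A = A \<Longrightarrow> transpose (complexify A) = complexify A"
  by (simp add: sym3)

text \<open>At (1, i, 0) the quadratic form has real part \<open>A$1$1 - A$2$2\<close> and imaginary
  part \<open>2 * A$1$2\<close>.\<close>

lemma circle_iff:
  assumes "real_conic A"
  shows "circle A \<longleftrightarrow> A$1$1 = A$2$2 \<and> A$1$2 = 0"
proof -
  have s: "A$2$1 = A$1$2" using assms by (simp add: real_conic_def sym3)
  show ?thesis
    using assms
    by (auto simp: circle_def on_conic_bform bform_coords circle_pt_I_def circle_pt_J_def s
        vec_eq_iff forall_3 complex_eq_iff)
qed

section \<open>The confocal pencil\<close>

text \<open>The bilinear form of K: the Euclidean inner product of the normal vectors of two lines.
  It is positive semidefinite over the reals and vanishes on the line at infinity.\<close>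

definition kdot :: "'a::comm_ring_1 ^ 3 \<Rightarrow> 'a ^ 3 \<Rightarrow> 'a" where
  "kdot x y = x$1 * y$1 + x$2 * y$2"

definition pencil :: "'a::comm_ring_1 ^ 3 ^ 3 \<Rightarrow> 'a \<Rightarrow> 'a ^ 3 ^ 3" where
  "pencil M t = vector [vector [M$1$1 + t, M$1$2, M$1$3],
                        vector [M$2$1, M$2$2 + t, M$2$3],
                        vector [M$3$1, M$3$2, M$3$3]]"

lemma pencil_nth [simp]:
  "pencil M t $ 1 $ 1 = M$1$1 + t" "pencil M t $ 1 $ 2 = M$1$2" "pencil M t $ 1 $ 3 = M$1$3"
  "pencil M t $ 2 $ 1 = M$2$1" "pencil M t $ 2 $ 2 = M$2$2 + t" "pencil M t $ 2 $ 3 = M$2$3"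
  "pencil M t $ 3 $ 1 = M$3$1" "pencil M t $ 3 $ 2 = M$3$2" "pencil M t $ 3 $ 3 = M$3$3"
  by (simp_all add: pencil_def)

lemma transpose_pencil: "transpose M = M \<Longrightarrow> transpose (pencil M t) = pencil M t"
  by (simp add: sym3)

lemma bform_pencil: "bform (pencil M t) x y = bform M x y + t * kdot x y"
  by (simp add: bform_coords kdot_def algebra_simps)

lemma kdot_sym: "kdot x y = kdot y x"
  by (simp add: kdot_def mult.commute)

lemma kdot_add_right: "kdot x (y + z) = kdot x y + kdot x z"
  and kdot_diff_right: "kdot x (y - z) = kdot x y - kdot x z"
  and kdot_scale_right: "kdot x (k *s y) = k * kdot x y"
  and kdot_add_left: "kdot (x + y) z = kdot x z + kdot y z"
  and kdot_diff_left: "kdot (x - y) z = kdot x z - kdot y z"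
  and kdot_scale_left: "kdot (k *s x) z = k * kdot x z"
  by (simp_all add: kdot_def algebra_simps)

lemmas kdot_linear = kdot_add_right kdot_diff_right kdot_scale_right
  kdot_add_left kdot_diff_left kdot_scale_left

text \<open>These are the entries that decide whether a conic is a circle. Since \<open>t\<close>
  cancels in them, the whole pencil inherits from X that no member is one.\<close>

lemma adj3_pencil_circle:
  assumes "transpose M = M"
  shows "adj3 (pencil M t) $ 1 $ 1 - adj3 (pencil M t) $ 2 $ 2 = adj3 M $ 1 $ 1 - adj3 M $ 2 $ 2"
    and "adj3 (pencil M t) $ 1 $ 2 = adj3 M $ 1 $ 2"
  using assms by (simp_all add: sym3 adj3_def algebra_simps)

text \<open>The entry is the determinant of X restricted to the line at infinity. If it vanished,
  the restricted form would have a real zero \<open>v\<close>, a point at infinity on the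
  ellipse.\<close>

lemma ellipse_adj3_33:
  assumes "ellipse X"
  shows "adj3 X $ 3 $ 3 \<noteq> 0"
proof
  assume 0: "adj3 X $ 3 $ 3 = 0"
  have s: "X$2$1 = X$1$2" using assms by (simp add: ellipse_def real_conic_def sym3)
  define v :: "real^3" where
    "v = (if X$1$1 = 0 then vector [1, 0, 0] else vector [- (X$1$2), X$1$1, 0])"
  have "bform X v v = 0" "v \<noteq> 0" "v$3 = 0"
    using 0 by (auto simp: v_def bform_coords adj3_def s vec_eq_iff forall_3 algebra_simps)
  thus False
    using assms by (auto simp: ellipse_def on_conic_bform)
qed

section \<open>Confocality as membership in the pencil, up to a factor\<close>

lemma isotropic_tangents_iff:
  assumes "real_conic A"
  shows "l \<in> isotropic_tangents A \<longleftrightarrow> l \<noteq> 0 \<and> bform (complexify (adj3 A)) l l = 0 \<and>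
    (l$1 + \<i> * l$2 = 0 \<or> l$1 - \<i> * l$2 = 0)"
proof -
  have "tangent_to l (complexify A) \<longleftrightarrow> l \<noteq> 0 \<and> bform (complexify (adj3 A)) l l = 0"
    using assms by (subst tangent_to_iff)
      (auto simp: real_conic_def transpose_complexify det_complexify adj3_complexify)
  thus ?thesis
    by (auto simp: isotropic_tangents_def scalar_product_def sum_3 circle_pt_I_def circle_pt_J_def
        mult.commute)
qed

text \<open>Two distinct roots determine a quadratic up to a factor. Substituting
  \<open>z = w / m2\<close> turns the roots into \<open>w = r - m1\<close> and
  \<open>w = - r - m1\<close>; subtracting the two equations isolates the linear
  coefficient.\<close>

lemma quadratic_same_roots:
  fixes m0 m1 m2 n0 n1 n2 :: complex
  assumes "m2 \<noteq> 0" "m1\<^sup>2 - m2 * m0 \<noteq> 0"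
    and roots: "\<And>z. m0 + 2 * m1 * z + m2 * z\<^sup>2 = 0 \<Longrightarrow> n0 + 2 * n1 * z + n2 * z\<^sup>2 = 0"
  shows "m2 * n1 = n2 * m1" "m2 * n0 = n2 * m0"
proof -
  define r where "r = csqrt (m1\<^sup>2 - m2 * m0)"
  have r: "r\<^sup>2 = m1\<^sup>2 - m2 * m0" "r \<noteq> 0"
    using assms(2) by (auto simp: r_def)
  have *: "m2\<^sup>2 * n0 + 2 * n1 * m2 * w + n2 * w\<^sup>2 = 0" if w: "(w + m1)\<^sup>2 = r\<^sup>2" for w
  proof -
    have "m0 * m2 + 2 * m1 * w + w\<^sup>2 = 0"
      using w r(1) by algebra
    hence "m0 + 2 * m1 * (w / m2) + m2 * (w / m2)\<^sup>2 = 0"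
      using assms(1) by (simp add: field_simps power2_eq_square)
    from roots[OF this] show ?thesis
      using assms(1) by (simp add: field_simps power2_eq_square)
  qed
  have p: "m2\<^sup>2 * n0 + 2 * n1 * m2 * (r - m1) + n2 * (r - m1)\<^sup>2 = 0"
    and q: "m2\<^sup>2 * n0 + 2 * n1 * m2 * (- r - m1) + n2 * (- r - m1)\<^sup>2 = 0"
    by (rule *; simp add: power2_eq_square)+
  have "4 * r * (m2 * n1 - n2 * m1) = 0"
    using p q by algebra
  thus 1: "m2 * n1 = n2 * m1"
    using r(2) by simp
  have "m2 * (m2 * n0 - n2 * m0) = 0"
    using p 1 r(1) by algebra
  thus "m2 * n0 = n2 * m0"
    using assms(1) by simp
qed

text \<open>A line through I is, up to a factor, (1, i, z) or the line at infinity. On the former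
  each dual conic is a quadratic in z; equal roots make the quadratics proportional, and real and
  imaginary parts then fix all entries except the sum of the first two diagonal ones, which is the
  freedom in \<open>t\<close>.\<close>

lemma confocal_imp_pencil:
  assumes X: "ellipse X" "\<not> circle X" and R: "real_conic R" and conf: "confocal R X"
  obtains k t where "k \<noteq> 0" "\<And>i j. pencil (adj3 X) t $ i $ j = k * adj3 R $ i $ j"
proof -
  define M N where "M = adj3 X" and "N = adj3 R"
  have rX: "real_conic X" using X by (simp add: ellipse_def)
  have tX: "transpose X = X" "det X \<noteq> 0" using rX by (auto simp: real_conic_def)
  have sM: "M$2$1 = M$1$2" "M$3$1 = M$1$3" "M$3$2 = M$2$3"
    using transpose_adj3[OF tX(1)] by (auto simp: M_def sym3)
  have sN: "N$2$1 = N$1$2" "N$3$1 = N$1$3" "N$3$2 = N$2$3"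
    using R transpose_adj3[of R] by (auto simp: N_def sym3 real_conic_def)
  have M33: "M$3$3 \<noteq> 0" using ellipse_adj3_33[OF X(1)] by (simp add: M_def)
  have iso: "bform (complexify M) l l = 0 \<longleftrightarrow> bform (complexify N) l l = 0"
    if "l \<noteq> 0" "l$1 + \<i> * l$2 = 0" for l
    using conf that isotropic_tangents_iff[OF R, of l] isotropic_tangents_iff[OF rX, of l]
    by (auto simp: confocal_def M_def N_def)
  \<comment> \<open>The line at infinity passes through I and is not tangent to X, so it is not
    tangent to R either.\<close>
  have N33: "N$3$3 \<noteq> 0"
    using iso[of "vector [0, 0, 1]"] M33
    by (auto simp: bform_coords vec_eq_iff forall_3)
  have roots: "Complex (M$1$1 - M$2$2) (2 * M$1$2) + 2 * Complex (M$1$3) (M$2$3) * z + M$3$3 * z\<^sup>2 = 0 \<longleftrightarrow>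
     Complex (N$1$1 - N$2$2) (2 * N$1$2) + 2 * Complex (N$1$3) (N$2$3) * z + N$3$3 * z\<^sup>2 = 0" for z :: complex
  proof -
    have "bform (complexify A) (vector [1, \<i>, z]) (vector [1, \<i>, z]) =
      Complex (A$1$1 - A$2$2) (2 * A$1$2) + 2 * Complex (A$1$3) (A$2$3) * z + A$3$3 * z\<^sup>2"
      if "A$2$1 = A$1$2" "A$3$1 = A$1$3" "A$3$2 = A$2$3" for A
      using that by (simp add: bform_coords Complex_eq power2_eq_square algebra_simps)
    thus ?thesis
      using iso[of "vector [1, \<i>, z]"] sM sN by (simp add: vec_eq_iff forall_3)
  qed
  \<comment> \<open>The minors of M are the entries of X times \<open>det X\<close>. This identifies
    the discriminant with a quantity that vanishes only for a circle.\<close>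
  have "adj3 M $ i $ j = det X * X $ i $ j" for i j
    by (simp add: M_def adj3_adj3)
  from this[of 1 1] this[of 2 2] this[of 1 2]
  have "(Complex (M$1$3) (M$2$3))\<^sup>2 - M$3$3 * Complex (M$1$1 - M$2$2) (2 * M$1$2) =
      det X * Complex (X$1$1 - X$2$2) (2 * X$1$2)"
    by (simp add: adj3_def sM complex_eq_iff power2_eq_square algebra_simps)
  moreover have "Complex (X$1$1 - X$2$2) (2 * X$1$2) \<noteq> 0"
    using X(2) circle_iff[OF rX] by (auto simp: complex_eq_iff)
  ultimately have disc: "(Complex (M$1$3) (M$2$3))\<^sup>2 - M$3$3 * Complex (M$1$1 - M$2$2) (2 * M$1$2) \<noteq> 0"
    using tX(2) by simp
  have "M$3$3 * Complex (N$1$3) (N$2$3) = N$3$3 * Complex (M$1$3) (M$2$3)"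
    and "M$3$3 * Complex (N$1$1 - N$2$2) (2 * N$1$2) = N$3$3 * Complex (M$1$1 - M$2$2) (2 * M$1$2)"
    using quadratic_same_roots[OF _ disc, of _ _ "of_real (N$3$3)"] roots M33 by auto
  hence e: "M$3$3 * N$1$3 = N$3$3 * M$1$3" "M$3$3 * N$2$3 = N$3$3 * M$2$3"
    "M$3$3 * N$1$2 = N$3$3 * M$1$2"
    "M$3$3 * (N$1$1 - N$2$2) = N$3$3 * (M$1$1 - M$2$2)"
    by (auto simp: complex_eq_iff)
  \<comment> \<open>\<open>k\<close> matches the entries at position 3,3 and \<open>t\<close> those
    at 1,1; the equations \<open>e\<close> take care of the others.\<close>
  define k where "k = M$3$3 / N$3$3"
  define t where "t = k * N$1$1 - M$1$1"
  have "\<forall>i j. pencil M t $ i $ j = k * N $ i $ j"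
    using e N33 by (simp add: forall_3 sM sN t_def k_def field_simps)
  moreover have "k \<noteq> 0" using M33 N33 by (simp add: k_def)
  ultimately show thesis
    using that by (auto simp: M_def N_def)
qed

text \<open>K is the product of the equations of I and J, so it vanishes on every isotropic line and
  all members of the pencil have the same isotropic tangents. The point \<open>P\<close> makes the
  conic real.\<close>

lemma pencil_confocal:
  assumes X: "ellipse X" "\<not> circle X" and D: "det (pencil (adj3 X) t) \<noteq> 0"
    and P: "on_conic (adj3 (pencil (adj3 X) t)) P"
  shows "real_conic (adj3 (pencil (adj3 X) t))" "confocal (adj3 (pencil (adj3 X) t)) X"
proof -
  define M N where "M = adj3 X" and "N = pencil (adj3 X) t"
  have rX: "real_conic X" using X by (simp add: ellipse_def)
  have tX: "transpose X = X" "det X \<noteq> 0" using rX by (auto simp: real_conic_def)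
  have tM: "transpose M = M" using tX by (simp add: M_def transpose_adj3)
  have tN: "transpose N = N" using tM by (simp add: M_def N_def transpose_pencil)
  have dN: "det N \<noteq> 0" using D by (simp add: N_def)
  have rR: "real_conic (adj3 N)"
    using dN P transpose_adj3[OF tN] unfolding real_conic_def det_adj3 N_def[symmetric] by auto
  thus "real_conic (adj3 (pencil (adj3 X) t))"
    by (simp only: N_def)
  have "adj3 N $ 1 $ 1 - adj3 N $ 2 $ 2 = det X * (X$1$1 - X$2$2)" "adj3 N $ 1 $ 2 = det X * X$1$2"
    using adj3_pencil_circle[OF tM, of t]
    unfolding N_def M_def adj3_adj3 by (simp_all only: right_diff_distrib)
  hence nc: "\<not> circle (adj3 N)"
    using X(2) tX(2) circle_iff[OF rX] circle_iff[OF rR] by auto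
  have "l \<in> isotropic_tangents (adj3 N) \<longleftrightarrow> l \<in> isotropic_tangents X" for l
  proof -
    have eq: "bform (complexify (adj3 (adj3 N))) l l = det N * bform (complexify M) l l"
      if "l$1 + \<i> * l$2 = 0 \<or> l$1 - \<i> * l$2 = 0"
    proof -
      have "(l$1 + \<i> * l$2) * (l$1 - \<i> * l$2) = 0" using that by simp
      hence "kdot l l = 0" by (simp add: kdot_def algebra_simps)
      moreover have "complexify N = pencil (complexify M) t"
        by (simp add: vec_eq_iff forall_3 N_def M_def)
      ultimately have "bform (complexify N) l l = bform (complexify M) l l"
        by (simp add: bform_pencil)
      moreover have "bform (complexify (adj3 (adj3 N))) l l = det N * bform (complexify N) l l"
        by (simp add: bform_coords adj3_adj3 algebra_simps)
      ultimately show ?thesis by simp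
    qed
    have "of_real (det N) \<noteq> (0 :: complex)" using dN by simp
    thus ?thesis
      unfolding isotropic_tangents_iff[OF rR] isotropic_tangents_iff[OF rX] M_def[symmetric]
      using eq mult_eq_0_iff by metis
  qed
  hence "confocal (adj3 N) X"
    using nc X(2) by (auto simp: confocal_def)
  thus "confocal (adj3 (pencil (adj3 X) t)) X"
    by (simp only: N_def)
qed

lemma confocal_through_iff:
  assumes X: "ellipse X" "\<not> circle X" and PQ: "P \<noteq> 0" "Q \<noteq> 0"
  shows "(\<exists>R. real_conic R \<and> confocal R X \<and> on_conic R P \<and> on_conic R Q) \<longleftrightarrow>
    (\<exists>t. det (pencil (adj3 X) t) \<noteq> 0 \<and> bform (adj3 (pencil (adj3 X) t)) P P = 0 \<and>
      bform (adj3 (pencil (adj3 X) t)) Q Q = 0)" (is "?l \<longleftrightarrow> ?r")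
proof
  assume ?l
  then obtain R where R: "real_conic R" "confocal R X" "bform R P P = 0" "bform R Q Q = 0"
    by (auto simp: on_conic_bform)
  obtain k t where k: "k \<noteq> 0" "\<And>i j. pencil (adj3 X) t $ i $ j = k * adj3 R $ i $ j"
    using confocal_imp_pencil[OF X R(1,2)] by metis
  have "det (pencil (adj3 X) t) = k ^ 3 * det (adj3 R)"
    by (simp add: det_3[of "pencil _ _"] k(2) del: pencil_nth)
      (simp add: det_3 algebra_simps power3_eq_cube)
  \<comment> \<open>The adjugate is quadratic, which squares the factor \<open>k\<close>, and the
    double adjugate of R is \<open>det R\<close> times R.\<close>
  moreover have "adj3 (pencil (adj3 X) t) $ i $ j = k\<^sup>2 * det R * R $ i $ j" for i j
  proof -
    have "\<forall>i j. adj3 (pencil (adj3 X) t) $ i $ j = k\<^sup>2 * adj3 (adj3 R) $ i $ j"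
      by (simp add: forall_3 adj3_def[of "pencil _ _"] k(2) del: pencil_nth)
        (simp add: adj3_def[of "adj3 R"] algebra_simps power2_eq_square)
    thus ?thesis by (simp add: adj3_adj3)
  qed
  hence "bform (adj3 (pencil (adj3 X) t)) x x = k\<^sup>2 * det R * bform R x x" for x
    by (simp add: bform_coords algebra_simps)
  ultimately show ?r
    using R k(1) by (auto simp: real_conic_def det_adj3 intro!: exI[of _ t])
next
  assume ?r
  then obtain t where t: "det (pencil (adj3 X) t) \<noteq> 0" "on_conic (adj3 (pencil (adj3 X) t)) P"
      "on_conic (adj3 (pencil (adj3 X) t)) Q"
    using PQ by (auto simp: on_conic_bform)
  thus ?l using pencil_confocal[OF X t(1,2)] by blast
qed

section \<open>Common tangent circles\<close>

lemma inner3: "x \<bullet> y = x$1 * y$1 + x$2 * y$2 + x$3 * y$3" for x y :: "real ^ 3"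
  by (simp add: inner_vec_def sum_3)

lemma cross3_nth:
  "cross3 a b $ 1 = a$2 * b$3 - a$3 * b$2"
  "cross3 a b $ 2 = a$3 * b$1 - a$1 * b$3"
  "cross3 a b $ 3 = a$1 * b$2 - a$2 * b$1"
  by (simp_all add: cross3_def)

text \<open>A Gram determinant: the meet of two lines is on the conic iff the dual form degenerates
  on the lines through it.\<close>

lemma bform_adj3_cross3:
  assumes "transpose N = N"
  shows "bform (adj3 N) (cross3 a b) (cross3 a b) = bform N a a * bform N b b - (bform N a b)\<^sup>2"
proof -
  have s: "N$2$1 = N$1$2" "N$3$1 = N$1$3" "N$3$2 = N$2$3" using assms by (auto simp: sym3)
  show ?thesis
    by (simp add: bform_coords cross3_nth adj3_def s power2_eq_square algebra_simps)
qed

lemma cross3_eq_0_scale: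
  assumes "cross3 a b = 0" "a \<noteq> 0"
  obtains k where "b = k *s a"
proof -
  have "b = 0 \<or> (\<exists>c. b = c *\<^sub>R a)"
    using assms by (auto simp: cross_eq_0 collinear_lemma)
  thus thesis using that[of 0] that by (auto simp: vec_eq_iff)
qed

lemma cross3_scale: "cross3 (k *s a) (l *s b) = (k * l) *s cross3 a b"
  by (simp add: vec_eq_iff forall_3 cross3_nth algebra_simps)

section \<open>Coordinates with respect to three non-concurrent lines\<close>

definition triple :: "real ^ 3 \<Rightarrow> real ^ 3 \<Rightarrow> real ^ 3 \<Rightarrow> real" where
  "triple a b c = cross3 a b \<bullet> c"

lemma triple_coords: "triple a b c = (a$2 * b$3 - a$3 * b$2) * c$1 + (a$3 * b$1 - a$1 * b$3) * c$2 +
    (a$1 * b$2 - a$2 * b$1) * c$3"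
  by (simp add: triple_def inner3 cross3_nth)

lemma cramer_span:
  "triple a b c *s d = triple d b c *s a + triple a d c *s b + triple a b d *s c"
  by (simp add: vec_eq_iff forall_3 triple_coords algebra_simps)

lemma triple_basis:
  assumes "triple a b c \<noteq> 0"
  obtains x y z where "d = x *s a + y *s b + z *s c"
proof -
  define D where "D = triple a b c"
  have "d = (triple d b c / D) *s a + (triple a d c / D) *s b + (triple a b d / D) *s c"
    using cramer_span[of a b c d] assms unfolding D_def[symmetric]
    by (simp add: vec_eq_iff forall_3 field_simps)
  thus thesis by (rule that)
qed

lemma triple_solve:
  assumes "triple a b c \<noteq> 0"
  obtains p where "p \<bullet> a = u" "p \<bullet> b = v" "p \<bullet> c = w"
proof -
  define D where "D = triple a b c"
  \<comment> \<open>The three cross products are, up to the factor \<open>D\<close>, the basis dual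
    to \<open>a\<close>, \<open>b\<close>, \<open>c\<close>.\<close>
  define r where "r = u *s cross3 b c + v *s cross3 c a + w *s cross3 a b"
  have "r \<bullet> a = u * D" "r \<bullet> b = v * D" "r \<bullet> c = w * D"
    by (simp_all add: r_def D_def triple_coords inner3 cross3_nth algebra_simps)
  hence "((1 / D) *s r) \<bullet> a = u" "((1 / D) *s r) \<bullet> b = v" "((1 / D) *s r) \<bullet> c = w"
    using assms by (simp_all add: D_def[symmetric] inner3 field_simps)
  thus thesis by (rule that)
qed

text \<open>Squared and cleared of denominators, the equation says that the centre \<open>p\<close>
  has distance \<open>q / p$3\<close>, up to sign, from the line \<open>l\<close>.\<close>

lemma circle_tangents_iff:
  assumes "L \<noteq> {}" "\<And>l. l \<in> L \<Longrightarrow> l \<noteq> 0"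
  shows "(\<exists>C. circle C \<and> (\<forall>l\<in>L. tangent_to l C)) \<longleftrightarrow>
    (\<exists>p q. p$3 \<noteq> 0 \<and> q \<noteq> 0 \<and> (\<forall>l\<in>L. (p \<bullet> l)\<^sup>2 = q\<^sup>2 * kdot l l))" (is "?l \<longleftrightarrow> ?r")
proof
  assume ?l
  then obtain C where C: "circle C" "\<And>l. l \<in> L \<Longrightarrow> tangent_to l C" by blast
  have rC: "real_conic C" using C(1) by (simp add: circle_def)
  hence tC: "transpose C = C" "det C \<noteq> 0" by (auto simp: real_conic_def)
  have s: "C$2$1 = 0" "C$3$1 = C$1$3" "C$3$2 = C$2$3" "C$1$1 = C$2$2" "C$1$2 = 0"
    using tC(1) C(1) circle_iff[OF rC] by (auto simp: sym3)
  \<comment> \<open>The homogeneous centre, from completing the squares in the equation of the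
    circle; \<open>e\<close> is the squared radius times the square of \<open>p$3\<close>.\<close>
  define p :: "real^3" where "p = vector [- C$1$3, - C$2$3, C$2$2]"
  define e where "e = (C$1$3)\<^sup>2 + (C$2$3)\<^sup>2 - C$2$2 * C$3$3"
  have det: "det C = - C$2$2 * e"
    by (simp add: det_3 s e_def power2_eq_square algebra_simps)
  have p3: "p$3 \<noteq> 0" and e0: "e \<noteq> 0" using tC(2) by (auto simp: det p_def)
  have eq: "(p \<bullet> l)\<^sup>2 = e * kdot l l" if "l \<in> L" for l
  proof -
    have "bform (adj3 C) l l = (p \<bullet> l)\<^sup>2 - e * kdot l l"
      by (simp add: bform_coords adj3_def s inner3 p_def e_def kdot_def power2_eq_square algebra_simps)
    thus ?thesis using C(2)[OF that] tangent_to_iff[OF tC] by simp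
  qed
  \<comment> \<open>An imaginary circle has no real tangent: both sides of \<open>eq\<close> would
    vanish, leaving only the zero vector.\<close>
  have "e > 0"
  proof (rule ccontr)
    assume "\<not> e > 0"
    with e0 have "e < 0" by simp
    obtain l where l: "l \<in> L" using assms(1) by blast
    have "kdot l l \<ge> 0" by (simp add: kdot_def)
    with eq[OF l] \<open>e < 0\<close> have "kdot l l = 0" "p \<bullet> l = 0"
      by (metis linorder_not_less mult_neg_pos order_le_less zero_le_power2,
          metis linorder_not_less mult_neg_pos mult_zero_right order_le_less zero_le_power2 power_eq_0_iff)
    hence "l = 0"
      using p3 by (auto simp: kdot_def inner3 vec_eq_iff forall_3 sum_squares_eq_zero_iff)
    thus False using assms(2) l by blast
  qed
  thus ?r using eq p3 by (intro exI[of _ p] exI[of _ "sqrt e"]) auto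
next
  assume ?r
  then obtain p q where pq: "p$3 \<noteq> 0" "q \<noteq> 0" "\<And>l. l \<in> L \<Longrightarrow> (p \<bullet> l)\<^sup>2 = q\<^sup>2 * kdot l l"
    by blast
  \<comment> \<open>The constant term of the equation of the circle with centre \<open>p\<close> and
    radius \<open>q / p$3\<close>, multiplied by \<open>p$3\<close>.\<close>
  define e where "e = ((p$1)\<^sup>2 + (p$2)\<^sup>2 - q\<^sup>2) / p$3"
  have e: "e * p$3 = (p$1)\<^sup>2 + (p$2)\<^sup>2 - q\<^sup>2" using pq(1) by (simp add: e_def)
  define C :: "real^3^3" where
    "C = vector [vector [p$3, 0, - p$1], vector [0, p$3, - p$2], vector [- p$1, - p$2, e]]"
  have tC: "transpose C = C" by (simp add: sym3 C_def)
  have "det C = p$3 * (e * p$3 - (p$1)\<^sup>2 - (p$2)\<^sup>2)"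
    by (simp add: det_3 C_def power2_eq_square algebra_simps)
  hence dC: "det C \<noteq> 0" using pq(1,2) e by simp
  have "bform (adj3 C) l l = (p \<bullet> l)\<^sup>2 + (e * p$3 - (p$1)\<^sup>2 - (p$2)\<^sup>2) * kdot l l" for l
    by (simp add: bform_coords adj3_def C_def inner3 kdot_def power2_eq_square algebra_simps)
  hence tan: "tangent_to l C" if "l \<in> L" for l
    using that pq(3) e assms(2) tangent_to_iff[OF tC dC] by simp
  hence "\<exists>x. on_conic C x"
    using assms(1) by (auto simp: tangent_to_def)
  hence rC: "real_conic C" using tC dC by (simp add: real_conic_def)
  have "circle C" using circle_iff[OF rC] by (simp add: C_def)
  thus ?l using tan by blast
qed

section \<open>Tangents and axes of an ellipse\<close>

locale noncircular_ellipse =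
  fixes X :: "real ^ 3 ^ 3"
  assumes ellipse: "ellipse X" and not_circle: "\<not> circle X"
begin

abbreviation M where "M \<equiv> adj3 X"

lemma real_conic_X: "real_conic X"
  using ellipse by (simp add: ellipse_def)

lemma sym_X: "transpose X = X" and det_X: "det X \<noteq> 0"
  using real_conic_X by (auto simp: real_conic_def)

lemma sym_M: "transpose M = M"
  by (simp add: sym_X transpose_adj3)

lemma bform_M_sym: "bform M x y = bform M y x"
  by (rule bform_sym[OF sym_M])

lemma tangent_iff: "tangent_to l X \<longleftrightarrow> l \<noteq> 0 \<and> bform M l l = 0"
  by (rule tangent_to_iff[OF sym_X det_X])

lemma M_inj: "M *v x = 0 \<Longrightarrow> x = 0"
  using matrix_vector_adj3[of X x] det_X by simp

text \<open>Only the line at infinity has a zero normal vector, and it is not tangent to an ellipse.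
  Thus the lift of a tangent has nonzero last coordinate.\<close>

lemma tangent_kdot_pos:
  assumes "tangent_to l X"
  shows "kdot l l > 0"
proof (rule ccontr)
  assume "\<not> kdot l l > 0"
  moreover have "kdot l l \<ge> 0" by (simp add: kdot_def)
  ultimately have "kdot l l = 0" by simp
  hence l: "l$1 = 0" "l$2 = 0" by (auto simp: kdot_def sum_squares_eq_zero_iff)
  hence "l$3 \<noteq> 0" using assms by (auto simp: tangent_iff vec_eq_iff forall_3)
  thus False
    using assms l ellipse_adj3_33[OF ellipse] by (auto simp: tangent_iff bform_coords)
qed

text \<open>Two conjugate tangents would span a totally isotropic plane of the nondegenerate form M
  on three-space. Concretely, \<open>M *v a\<close> and \<open>M *v b\<close> would both be
  multiples of the meet \<open>P\<close>, contradicting injectivity of M.\<close>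

lemma tangents_conjugate:
  assumes "tangent_to a X" "tangent_to b X" "cross3 a b \<noteq> 0"
  shows "bform M a b \<noteq> 0"
proof
  assume 0: "bform M a b = 0"
  define P where "P = cross3 a b"
  have ab: "bform M a a = 0" "bform M b b = 0" "bform M b a = 0"
    using assms 0 bform_M_sym by (auto simp: tangent_iff)
  have "cross3 P (M *v a) = bform M a a *s b - bform M b a *s a"
    "cross3 P (M *v b) = bform M a b *s b - bform M b b *s a"
    by (simp_all add: P_def vec_eq_iff forall_3 cross3_nth bform_def coords3 algebra_simps)
  hence "cross3 P (M *v a) = 0" "cross3 P (M *v b) = 0" using ab 0 by simp_all
  then obtain x y where xy: "M *v a = x *s P" "M *v b = y *s P"
    using cross3_eq_0_scale[of P] assms(3) unfolding P_def by metis
  have "M *v (y *s a - x *s b) = y *s (M *v a) - x *s (M *v b)"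
    by (simp add: coords3 algebra_simps)
  also have "\<dots> = 0"
    unfolding xy by (simp add: vec_eq_iff)
  finally have "M *v (y *s a - x *s b) = 0" .
  hence e: "y *s a = x *s b" using M_inj by force
  have "y = 0 \<and> x = 0"
  proof -
    have "cross3 (y *s a) b = y *s P" "cross3 a (x *s b) = x *s P"
      by (simp_all add: P_def vec_eq_iff forall_3 cross3_nth algebra_simps)
    moreover have "cross3 (x *s b) b = 0" "cross3 a (y *s a) = 0"
      by (simp_all add: vec_eq_iff forall_3 cross3_nth)
    ultimately show ?thesis using e assms(3) by (auto simp: P_def)
  qed
  hence "a = 0" using xy M_inj by simp
  thus False using assms(1) by (simp add: tangent_iff)
qed

text \<open>Dually: three distinct points of a nondegenerate conic are not collinear. In a relation,
  two terms sum to an isotropic vector, so the product of their coefficients vanishes; hence at most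
  one coefficient survives.\<close>

lemma tangents_independent:
  assumes t: "tangent_to a X" "tangent_to b X" "tangent_to c X"
    and c: "cross3 a b \<noteq> 0" "cross3 a c \<noteq> 0" "cross3 b c \<noteq> 0"
    and 0: "x *s a + y *s b + z *s c = 0"
  shows "x = 0 \<and> y = 0 \<and> z = 0"
proof -
  have *: "u * v = 0" if "u *s p + v *s q + w *s r = 0" "tangent_to p X" "tangent_to q X"
      "tangent_to r X" "cross3 p q \<noteq> 0" for p q r u v w
  proof -
    have "u *s p + v *s q = (- w) *s r"
      using that(1) by (simp add: vec_eq_iff algebra_simps eq_neg_iff_add_eq_0)
    hence "bform M (u *s p + v *s q) (u *s p + v *s q) = bform M ((- w) *s r) ((- w) *s r)"
      by simp
    also have "\<dots> = 0"
      using that(4) unfolding bform_linear by (simp add: tangent_iff)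
    finally have "2 * u * v * bform M p q = 0"
      using that(2-4) bform_M_sym[of q p] by (simp add: bform_linear tangent_iff algebra_simps)
    thus ?thesis using tangents_conjugate[OF that(2,3,5)] by simp
  qed
  have "x * y = 0" "x * z = 0" "y * z = 0"
    using *[of x a y b z c] *[of x a z c y b] *[of y b z c x a] 0 t c
    by (simp_all add: add_ac)
  moreover have "a \<noteq> 0" "b \<noteq> 0" "c \<noteq> 0" using t by (auto simp: tangent_iff)
  ultimately show ?thesis using 0 by auto
qed

lemma tangents_triple:
  assumes t: "tangent_to a X" "tangent_to b X" "tangent_to c X"
    and c: "cross3 a b \<noteq> 0" "cross3 a c \<noteq> 0" "cross3 b c \<noteq> 0"
  shows "triple a b c \<noteq> 0"
proof
  assume 0: "triple a b c = 0"
  \<comment> \<open>Cramer's relation for the vector \<open>cross3 b c\<close>, whose first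
    coefficient is its own squared length.\<close>
  have "triple (cross3 b c) b c *s a + triple a (cross3 b c) c *s b + triple a b (cross3 b c) *s c = 0"
    using cramer_span[of a b c "cross3 b c"] 0 by simp
  hence "triple (cross3 b c) b c = 0" using tangents_independent[OF t c] by blast
  moreover have "triple (cross3 b c) b c = cross3 b c \<bullet> cross3 b c"
    by (simp add: triple_coords inner3 cross3_nth algebra_simps)
  ultimately show False using c(3) by simp
qed

text \<open>A generalised eigenvector, M n = s K n, that is, the kernel of a singular member of the
  pencil. The line at infinity is missing here, since K kills it: its eigenvalue would be
  infinite.\<close>

definition eigenline :: "real \<Rightarrow> real ^ 3 \<Rightarrow> bool" where
  "eigenline s n \<longleftrightarrow> n \<noteq> 0 \<and> pencil M (- s) *v n = 0"

lemma eigenline_bform: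
  assumes "eigenline s n"
  shows "bform M x n = s * kdot x n"
proof -
  have "bform (pencil M (- s)) x n = 0"
    using assms by (simp add: eigenline_def bform_def scalar_product_def)
  thus ?thesis by (simp add: bform_pencil)
qed

text \<open>M sends the polar of \<open>u\<close> back to a multiple of \<open>u\<close>, and
  perpendicularity says that \<open>u\<close> is parallel to the normal vector of the polar, that
  is, to K n.\<close>

lemma principal_axis_iff: "principal_axis X n \<longleftrightarrow> (\<exists>s. eigenline s n)"
proof
  assume "principal_axis X n"
  then obtain u where u: "u \<noteq> 0" "u$3 = 0" "n = X *v u" "n$1 * u$2 = n$2 * u$1"
    by (auto simp: principal_axis_def)
  have Mn: "M *v n = det X *s u" by (simp add: u(3) adj3_matrix_vector)
  have nz: "n \<noteq> 0" using Mn u(1) det_X by auto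
  \<comment> \<open>If the polar of \<open>u\<close> were the line at infinity, \<open>u\<close>
    would lie on its own polar and X would have a point at infinity.\<close>
  have "\<not> (n$1 = 0 \<and> n$2 = 0)"
  proof
    assume "n$1 = 0 \<and> n$2 = 0"
    hence "scalar_product u n = 0" using u(2) by (simp add: scalar_product_def sum_3)
    hence "on_conic X u" using u(1,3) by (simp add: on_conic_def)
    thus False using ellipse u(2) by (auto simp: ellipse_def)
  qed
  then obtain k where "u$1 = k * n$1" "u$2 = k * n$2"
  proof (cases "n$1 = 0")
    case True
    with that[of "u$2 / n$2"] u(4) \<open>\<not> (n$1 = 0 \<and> n$2 = 0)\<close> show thesis by auto
  next
    case False
    with that[of "u$1 / n$1"] u(4) show thesis by (simp add: field_simps)
  qed
  hence "pencil M (- (det X * k)) *v n = 0"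
    using Mn u(2) by (simp add: coords3 algebra_simps)
  thus "\<exists>s. eigenline s n" using nz by (auto simp: eigenline_def)
next
  assume "\<exists>s. eigenline s n"
  then obtain s where s: "n \<noteq> 0" "pencil M (- s) *v n = 0" by (auto simp: eigenline_def)
  \<comment> \<open>The eigenvalue equation dictates this choice: \<open>u\<close> is a multiple of
    K n, scaled such that its polar is exactly \<open>n\<close>.\<close>
  define u :: "real^3" where "u = (s / det X) *s vector [n$1, n$2, 0]"
  have "M *v n = det X *s u"
    using s(2) det_X by (simp add: u_def coords3 algebra_simps)
  hence "X *v (M *v n) = det X *s (X *v u)" by (simp add: vector_scalar_commute)
  hence "n = X *v u" using det_X by (simp add: matrix_vector_adj3)
  moreover from this have "u \<noteq> 0" using s(1) by auto
  ultimately show "principal_axis X n"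
    unfolding principal_axis_def by (intro exI[of _ u]) (auto simp: u_def)
qed

lemma exceptional_pair_iff: "exceptional_pair X P Q \<longleftrightarrow>
    (P$3 = 0 \<and> Q$3 = 0) \<or> (\<exists>s n. eigenline s n \<and> n \<bullet> P = 0 \<and> n \<bullet> Q = 0)"
  by (auto simp: exceptional_pair_def principal_axis_iff inner3 scalar_product_def sum_3)

text \<open>Hence every member of the pencil has rank at least two, and the kernel of a singular
  member is one line.\<close>

lemma adj3_pencil_nonzero:
  "adj3 (pencil M t) $ 1 $ 1 \<noteq> adj3 (pencil M t) $ 2 $ 2 \<or> adj3 (pencil M t) $ 1 $ 2 \<noteq> 0"
proof (rule ccontr)
  assume "\<not> ?thesis"
  hence "det X * X$1$1 = det X * X$2$2" "det X * X$1$2 = 0"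
    using adj3_pencil_circle[OF sym_M, of t] unfolding adj3_adj3 by simp_all
  hence "circle X" using det_X circle_iff[OF real_conic_X] by simp
  thus False using not_circle by simp
qed

text \<open>The adjugate of a symmetric matrix of rank two is a multiple of the square of its kernel
  vector \<open>n\<close>: as a conic it is the doubled line \<open>n\<close>, so its points are
  those of \<open>n\<close>.\<close>

lemma singular_pencil_kernel:
  assumes D: "det (pencil M t) = 0"
    and PQ: "bform (adj3 (pencil M t)) P P = 0" "bform (adj3 (pencil M t)) Q Q = 0"
  obtains n where "eigenline (- t) n" "n \<bullet> P = 0" "n \<bullet> Q = 0"
proof -
  define B where "B = adj3 (pencil M t)"
  have sB: "B$2$1 = B$1$2" "B$3$1 = B$1$3" "B$3$2 = B$2$3"
    using transpose_adj3[OF transpose_pencil[OF sym_M], of t] by (auto simp: B_def sym3)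
  have "adj3 B $ i $ j = 0" for i j
    by (simp add: B_def adj3_adj3 D)
  from this[of 1 1] this[of 2 2] this[of 3 3] this[of 1 2] this[of 1 3] this[of 2 3]
  have minors: "B$2$2 * B$3$3 = B$2$3 * B$2$3" "B$1$1 * B$3$3 = B$1$3 * B$1$3"
    "B$1$1 * B$2$2 = B$1$2 * B$1$2" "B$1$3 * B$2$3 = B$1$2 * B$3$3"
    "B$1$2 * B$2$3 = B$1$3 * B$2$2" "B$1$3 * B$1$2 = B$1$1 * B$2$3"
    by (simp_all add: adj3_def sB)
  have PQB: "bform B P P = 0" "bform B Q Q = 0" using PQ by (simp_all add: B_def)
  have "pencil M t *v (B *v e) = 0" for e
    by (simp add: B_def matrix_vector_adj3 D)
  hence eig: "eigenline (- t) (B *v e)" if "B *v e \<noteq> 0" for e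
    using that by (simp add: eigenline_def)
  \<comment> \<open>Otherwise the third minor makes \<open>B$1$2\<close> vanish too. A column with
    nonzero diagonal entry then serves as kernel vector.\<close>
  have "B$1$1 \<noteq> 0 \<or> B$2$2 \<noteq> 0"
    using adj3_pencil_nonzero[of t] minors(3) unfolding B_def[symmetric] by auto
  thus thesis
  proof
    assume b: "B$1$1 \<noteq> 0"
    define n where "n = B *v vector [1, 0, 0]"
    have n: "n$1 = B$1$1" "n$2 = B$1$2" "n$3 = B$1$3"
      by (simp_all add: n_def coords3 sB)
    have "(n \<bullet> P)\<^sup>2 = B$1$1 * bform B P P" for P
      using minors unfolding inner3 n bform_coords sB by algebra
    hence "n \<bullet> P = 0" "n \<bullet> Q = 0" using PQB by (metis mult_zero_right power_eq_0_iff)+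
    moreover have "n \<noteq> 0" using n b by auto
    ultimately show thesis using that eig unfolding n_def by blast
  next
    assume b: "B$2$2 \<noteq> 0"
    define n where "n = B *v vector [0, 1, 0]"
    have n: "n$1 = B$1$2" "n$2 = B$2$2" "n$3 = B$2$3"
      by (simp_all add: n_def coords3 sB)
    have "(n \<bullet> P)\<^sup>2 = B$2$2 * bform B P P" for P
      using minors unfolding inner3 n bform_coords sB by algebra
    hence "n \<bullet> P = 0" "n \<bullet> Q = 0" using PQB by (metis mult_zero_right power_eq_0_iff)+
    moreover have "n \<noteq> 0" using n b by auto
    ultimately show thesis using that eig unfolding n_def by blast
  qed
qed

end

section \<open>Quadrilaterals without exceptional pairs\<close>

text \<open>The unit normals have inner product 1 or -1 with the fixed vector (u, v), which leaves
  only two directions up to sign for three lines. This treats the functionals that have no proper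
  centre.\<close>

lemma chord_pigeonhole:
  fixes a b c :: "real ^ 3"
  assumes "(u * a$1 + v * a$2)\<^sup>2 = kdot a a" "kdot a a \<noteq> 0"
    and "(u * b$1 + v * b$2)\<^sup>2 = kdot b b" "kdot b b \<noteq> 0"
    and "(u * c$1 + v * c$2)\<^sup>2 = kdot c c" "kdot c c \<noteq> 0"
  shows "cross3 a b $ 3 = 0 \<or> cross3 a c $ 3 = 0 \<or> cross3 b c $ 3 = 0"
proof -
  define w x where "w l = u * l$1 + v * l$2" and "x l = u * l$2 - v * l$1" for l :: "real ^ 3"
  have sq: "(x l / w l)\<^sup>2 = u\<^sup>2 + v\<^sup>2 - 1"
    if "(u * l$1 + v * l$2)\<^sup>2 = kdot l l" "kdot l l \<noteq> 0" for l
  proof -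
    have "(x l)\<^sup>2 + (w l)\<^sup>2 = (u\<^sup>2 + v\<^sup>2) * kdot l l"
      by (simp add: x_def w_def kdot_def power2_eq_square algebra_simps)
    hence "(x l)\<^sup>2 = (u\<^sup>2 + v\<^sup>2 - 1) * (w l)\<^sup>2"
      using that(1) by (simp add: w_def[symmetric] algebra_simps)
    thus ?thesis using that by (simp add: w_def[symmetric] power_divide)
  qed
  \<comment> \<open>\<open>w\<close> and \<open>x\<close> are the components of the normal along and
    across (u, v); equal ratios mean parallel normals.\<close>
  have par: "cross3 k l $ 3 = 0"
    if "x k / w k = x l / w l" "w k \<noteq> 0" "w l \<noteq> 0" for k l
  proof -
    have "(u\<^sup>2 + v\<^sup>2) * cross3 k l $ 3 = w k * x l - x k * w l"
      by (simp add: x_def w_def cross3_nth power2_eq_square algebra_simps)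
    also have "\<dots> = 0" using that by (simp add: field_simps)
    finally have "(u\<^sup>2 + v\<^sup>2) * cross3 k l $ 3 = 0" .
    moreover have "u\<^sup>2 + v\<^sup>2 \<noteq> 0"
      using that(2) by (auto simp: w_def sum_power2_eq_zero_iff)
    ultimately show ?thesis by (metis mult_eq_0_iff)
  qed
  have "(x a / w a)\<^sup>2 = (x b / w b)\<^sup>2" "(x a / w a)\<^sup>2 = (x c / w c)\<^sup>2"
    using sq assms by simp_all
  hence "x a / w a = x b / w b \<or> x a / w a = x c / w c \<or> x b / w b = x c / w c"
    unfolding power2_eq_iff by auto
  moreover have "w a \<noteq> 0" "w b \<noteq> 0" "w c \<noteq> 0"
    using assms by (auto simp: w_def)
  ultimately show ?thesis using par by blast
qed

text \<open>The sign left open by the square root goes into \<open>v\<close>; this chooses the signs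
  that make two lifts conjugate.\<close>

lemma square_product_factors:
  fixes y t A B :: real
  assumes "y\<^sup>2 = t\<^sup>2 * A * B" "A \<ge> 0" "B \<ge> 0"
  obtains u v where "u\<^sup>2 = A" "v\<^sup>2 = B" "y = t * u * v"
proof -
  have "y\<^sup>2 = (t * sqrt A * sqrt B)\<^sup>2" using assms by (simp add: power_mult_distrib)
  hence "y = t * sqrt A * sqrt B \<or> y = t * sqrt A * (- sqrt B)"
    unfolding power2_eq_iff by simp
  thus thesis using that[of "sqrt A" "sqrt B"] that[of "sqrt A" "- sqrt B"] assms by auto
qed

context noncircular_ellipse
begin

text \<open>Parallel lines share a point at infinity, so three of them would be concurrent.\<close>

lemma no_three_parallel:
  assumes "triple a b c \<noteq> 0" "tangent_to a X"
  shows "\<not> (cross3 a b $ 3 = 0 \<and> cross3 a c $ 3 = 0)"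
proof
  assume *: "cross3 a b $ 3 = 0 \<and> cross3 a c $ 3 = 0"
  have "a$1 * cross3 b c $ 3 = 0" "a$2 * cross3 b c $ 3 = 0"
    using * unfolding cross3_nth by algebra+
  moreover have "a$1 \<noteq> 0 \<or> a$2 \<noteq> 0"
    using tangent_kdot_pos[OF assms(2)] by (auto simp: kdot_def)
  ultimately have "cross3 b c $ 3 = 0" by auto
  moreover have "triple a b c = a$3 * cross3 b c $ 3 - b$3 * cross3 a c $ 3 + c$3 * cross3 a b $ 3"
    by (simp add: triple_coords cross3_nth algebra_simps)
  ultimately show False using * assms(1) by simp
qed

lemma pencil_through_meet:
  assumes "tangent_to a X" "tangent_to b X"
  shows "bform (adj3 (pencil M t)) (cross3 a b) (cross3 a b) =
    t\<^sup>2 * kdot a a * kdot b b - (bform M a b + t * kdot a b)\<^sup>2"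
  using assms
  by (simp add: bform_adj3_cross3 transpose_pencil sym_M bform_pencil tangent_iff power2_eq_square)

text \<open>Both parts evaluate a form on \<open>x *s a + y *s b = d - z *s c\<close>. The second
  measures how far the lifts are from satisfying the relation of the lines.\<close>

lemma lifted_relation:
  assumes t: "tangent_to a X" "tangent_to b X" "tangent_to c X" "tangent_to d X"
    and w: "wa\<^sup>2 = kdot a a" "wb\<^sup>2 = kdot b b" "wc\<^sup>2 = kdot c c" "wd\<^sup>2 = kdot d d"
    and d: "d = x *s a + y *s b + z *s c"
  shows "x * y * bform M a b = - z * bform M c d"
    and "(x * wa + y * wb)\<^sup>2 - (wd - z * wc)\<^sup>2 =
      2 * (x * y * (wa * wb - kdot a b) + z * (wc * wd - kdot c d))"
proof -
  have e: "x *s a + y *s b = d - z *s c" using d by simp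
  have "bform M (x *s a + y *s b) (x *s a + y *s b) = bform M (d - z *s c) (d - z *s c)"
    unfolding e by simp
  thus "x * y * bform M a b = - z * bform M c d"
    using t bform_M_sym[of b a] bform_M_sym[of d c]
    by (simp add: bform_linear tangent_iff algebra_simps)
  have "kdot (x *s a + y *s b) (x *s a + y *s b) = kdot (d - z *s c) (d - z *s c)"
    unfolding e by simp
  hence "x\<^sup>2 * wa\<^sup>2 + y\<^sup>2 * wb\<^sup>2 + 2 * x * y * kdot a b = wd\<^sup>2 + z\<^sup>2 * wc\<^sup>2 - 2 * z * kdot c d"
    using kdot_sym[of b a] kdot_sym[of d c] w
    by (simp add: kdot_linear power2_eq_square algebra_simps)
  thus "(x * wa + y * wb)\<^sup>2 - (wd - z * wc)\<^sup>2 =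
      2 * (x * y * (wa * wb - kdot a b) + z * (wc * wd - kdot c d))"
    by algebra
qed

text \<open>The first exclusion keeps the conic found from the circle from being singular; all three
  keep the centre found from the conic from lying at infinity.\<close>

lemma circle_iff_confocal:
  assumes t: "tangent_to a X" "tangent_to b X" "tangent_to c X" "tangent_to d X"
    and c: "cross3 a b \<noteq> 0" "cross3 a c \<noteq> 0" "cross3 a d \<noteq> 0"
      "cross3 b c \<noteq> 0" "cross3 b d \<noteq> 0" "cross3 c d \<noteq> 0"
    and ne: "\<not> exceptional_pair X (cross3 a b) (cross3 c d)"
      "\<not> exceptional_pair X (cross3 a c) (cross3 b d)"
      "\<not> exceptional_pair X (cross3 a d) (cross3 b c)"
  shows "(\<exists>C. circle C \<and> (\<forall>l\<in>{a, b, c, d}. tangent_to l C)) \<longleftrightarrow>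
    (\<exists>R. real_conic R \<and> confocal R X \<and> on_conic R (cross3 a b) \<and> on_conic R (cross3 c d))"
    (is "?i \<longleftrightarrow> ?ii")
proof -
  have nz: "l \<noteq> 0" if "l \<in> {a, b, c, d}" for l
    using t that by (auto simp: tangent_iff)
  have kp: "kdot a a > 0" "kdot b b > 0" "kdot c c > 0" "kdot d d > 0"
    using t by (auto intro: tangent_kdot_pos)
  have i: "?i \<longleftrightarrow> (\<exists>p q. p$3 \<noteq> 0 \<and> q \<noteq> 0 \<and> (\<forall>l\<in>{a, b, c, d}. (p \<bullet> l)\<^sup>2 = q\<^sup>2 * kdot l l))"
    by (rule circle_tangents_iff) (simp, rule nz)
  have ii: "?ii \<longleftrightarrow> (\<exists>t. det (pencil M t) \<noteq> 0 \<and>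
      t\<^sup>2 * kdot a a * kdot b b - (bform M a b + t * kdot a b)\<^sup>2 = 0 \<and>
      t\<^sup>2 * kdot c c * kdot d d - (bform M c d + t * kdot c d)\<^sup>2 = 0)"
    unfolding confocal_through_iff[OF ellipse not_circle c(1,6)]
    by (simp only: pencil_through_meet[OF t(1,2)] pencil_through_meet[OF t(3,4)])
  have tri: "triple a b c \<noteq> 0" "triple a b d \<noteq> 0" "triple a c d \<noteq> 0" "triple b c d \<noteq> 0"
    using tangents_triple[OF t(1,2,3) c(1,2,4)] tangents_triple[OF t(1,2,4) c(1,3,5)]
      tangents_triple[OF t(1,3,4) c(2,3,6)] tangents_triple[OF t(2,3,4) c(4,5,6)] by simp_all
  obtain x y z where d: "d = x *s a + y *s b + z *s c"
    by (rule triple_basis[OF tri(1), of d])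
  have inner_d: "p \<bullet> d = x * (p \<bullet> a) + y * (p \<bullet> b) + z * (p \<bullet> c)" for p
    unfolding d by (simp add: inner3 algebra_simps)
  have z: "z \<noteq> 0"
  proof
    assume "z = 0"
    hence "x *s a + y *s b + (- 1) *s d = 0" by (simp add: d vec_eq_iff)
    from tangents_independent[OF t(1,2,4) c(1,3,5) this] show False by simp
  qed
  show ?thesis
  proof
    assume ?i
    then obtain p q where p: "p$3 \<noteq> 0" "q \<noteq> 0" "\<And>l. l \<in> {a, b, c, d} \<Longrightarrow> (p \<bullet> l)\<^sup>2 = q\<^sup>2 * kdot l l"
      unfolding i by blast
    define w where "w l = (p \<bullet> l) / q" for l
    have w: "(w l)\<^sup>2 = kdot l l" if "l \<in> {a, b, c, d}" for l
      using p(2,3) that by (simp add: w_def power_divide)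
    have pw: "p \<bullet> l = q * w l" for l using p(2) by (simp add: w_def)
    have wd: "w d = x * w a + y * w b + z * w c"
      using inner_d[of p] p(2) by (simp add: w_def field_simps)
    have w': "(w a)\<^sup>2 = kdot a a" "(w b)\<^sup>2 = kdot b b" "(w c)\<^sup>2 = kdot c c" "(w d)\<^sup>2 = kdot d d"
      by (intro w; simp)+
    note rel = lifted_relation[OF t w' d]
    \<comment> \<open>Equality in Cauchy-Schwarz would make \<open>v\<close> a multiple of the line
      at infinity. Since it passes through the finite centre \<open>p\<close>, it would vanish and
      \<open>a\<close>, \<open>b\<close> would coincide.\<close>
    have ab: "w a * w b \<noteq> kdot a b"
    proof
      assume e: "w a * w b = kdot a b"
      define v where "v = w b *s a - w a *s b"
      have "kdot v v = (w b)\<^sup>2 * kdot a a + (w a)\<^sup>2 * kdot b b - 2 * (w a * w b) * kdot a b"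
        using kdot_sym[of b a] by (simp add: v_def kdot_linear power2_eq_square algebra_simps)
      also have "\<dots> = 0"
        unfolding w'(1,2)[symmetric] e[symmetric] by (simp add: power2_eq_square)
      finally have v12: "v$1 = 0" "v$2 = 0" by (auto simp: kdot_def sum_squares_eq_zero_iff)
      have "p \<bullet> v = w b * (p \<bullet> a) - w a * (p \<bullet> b)"
        by (simp add: v_def inner3 algebra_simps)
      also have "\<dots> = 0" by (simp add: pw)
      finally have "v$3 = 0" using v12 p(1) by (simp add: inner3)
      hence "w b *s a = w a *s b" using v12 by (simp add: v_def vec_eq_iff forall_3)
      moreover have "cross3 (w b *s a) b = w b *s cross3 a b" "cross3 (w a *s b) b = 0"
        by (simp_all add: vec_eq_iff forall_3 cross3_nth algebra_simps)
      ultimately have "w b = 0" using c(1) by auto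
      thus False using w'(2) kp(2) by simp
    qed
    \<comment> \<open>The parameter for which the lifts of \<open>a\<close> and \<open>b\<close> are
      conjugate; the relation transfers this to \<open>c\<close> and \<open>d\<close>.\<close>
    define s where "s = bform M a b / (w a * w b - kdot a b)"
    have sab: "bform M a b = s * (w a * w b - kdot a b)" using ab by (simp add: s_def)
    have "x * y * (w a * w b - kdot a b) + z * (w c * w d - kdot c d) = 0"
      using rel(2) unfolding wd by (simp add: algebra_simps)
    hence "z * (bform M c d - s * (w c * w d - kdot c d)) = 0"
      using rel(1) sab by algebra
    hence scd: "bform M c d = s * (w c * w d - kdot c d)" using z by simp
    have on: "s\<^sup>2 * kdot a a * kdot b b - (bform M a b + s * kdot a b)\<^sup>2 = 0"
      "s\<^sup>2 * kdot c c * kdot d d - (bform M c d + s * kdot c d)\<^sup>2 = 0"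
      unfolding sab scd w'[symmetric] by (simp_all add: power2_eq_square algebra_simps)
    moreover have "det (pencil M s) \<noteq> 0"
    proof
      assume "det (pencil M s) = 0"
      then obtain n where "eigenline (- s) n" "n \<bullet> cross3 a b = 0" "n \<bullet> cross3 c d = 0"
        using on unfolding pencil_through_meet[OF t(1,2), symmetric] pencil_through_meet[OF t(3,4), symmetric]
        by (rule singular_pencil_kernel)
      thus False using ne(1) unfolding exceptional_pair_iff by blast
    qed
    ultimately show ?ii unfolding ii by blast
  next
    assume ?ii
    then obtain s where s: "s\<^sup>2 * kdot a a * kdot b b - (bform M a b + s * kdot a b)\<^sup>2 = 0"
      "s\<^sup>2 * kdot c c * kdot d d - (bform M c d + s * kdot c d)\<^sup>2 = 0"
      unfolding ii by blast
    have s0: "s \<noteq> 0" using s(1) tangents_conjugate[OF t(1,2) c(1)] by auto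
    have sq: "(bform M a b + s * kdot a b)\<^sup>2 = s\<^sup>2 * kdot a a * kdot b b"
      "(bform M c d + s * kdot c d)\<^sup>2 = s\<^sup>2 * kdot c c * kdot d d"
      using s by simp_all
    obtain wa wb where ab: "wa\<^sup>2 = kdot a a" "wb\<^sup>2 = kdot b b"
      "bform M a b + s * kdot a b = s * wa * wb"
      by (rule square_product_factors[OF sq(1) kp(1,2)[THEN less_imp_le]])
    obtain wc wd where cd: "wc\<^sup>2 = kdot c c" "wd\<^sup>2 = kdot d d"
      "bform M c d + s * kdot c d = s * wc * wd"
      by (rule square_product_factors[OF sq(2) kp(3,4)[THEN less_imp_le]])
    note rel = lifted_relation[OF t ab(1,2) cd(1,2) d]
    have "s * ((x * wa + y * wb)\<^sup>2 - (wd - z * wc)\<^sup>2) = 0"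
      unfolding rel(2) using rel(1) ab(3) cd(3) by algebra
    hence "(x * wa + y * wb)\<^sup>2 = (wd - z * wc)\<^sup>2" using s0 by simp
    \<comment> \<open>In the second case the signs of the lifts of \<open>c\<close> and
      \<open>d\<close> are reversed together, which preserves their squares.\<close>
    hence "wd = x * wa + y * wb + z * wc \<or> - wd = x * wa + y * wb + z * (- wc)"
      unfolding power2_eq_iff by auto
    then obtain wc' wd' where w': "wc'\<^sup>2 = kdot c c" "wd'\<^sup>2 = kdot d d"
      "wd' = x * wa + y * wb + z * wc'"
      using cd(1,2) by (metis power2_minus)
    \<comment> \<open>The functional is normalised to \<open>q = 1\<close>: three lifts determine
      it, and the relation makes it kill the fourth.\<close>
    obtain p where p: "p \<bullet> a = wa" "p \<bullet> b = wb" "p \<bullet> c = wc'"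
      by (rule triple_solve[OF tri(1)])
    have pd: "p \<bullet> d = wd'" by (simp add: inner_d p w'(3))
    have pl: "(p \<bullet> l)\<^sup>2 = 1\<^sup>2 * kdot l l" if "l \<in> {a, b, c, d}" for l
      using that p pd ab w' by auto
    \<comment> \<open>Otherwise any three of the lines include two parallels. As no three are
      parallel, the four split into two parallel pairs, and some pair of opposite vertices is at
      infinity.\<close>
    have "p$3 \<noteq> 0"
    proof
      assume p3: "p$3 = 0"
      have u: "(p$1 * l$1 + p$2 * l$2)\<^sup>2 = kdot l l" if "l \<in> {a, b, c, d}" for l
        using pl[OF that] p3 by (simp add: inner3)
      have par: "cross3 k l $ 3 = 0 \<or> cross3 k m $ 3 = 0 \<or> cross3 l m $ 3 = 0"
        if "k \<in> {a, b, c, d}" "l \<in> {a, b, c, d}" "m \<in> {a, b, c, d}" for k l m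
        using that kp by (intro chord_pigeonhole[of "p$1" k "p$2" l m] u) auto
      have sw: "cross3 k l $ 3 = 0 \<longleftrightarrow> cross3 l k $ 3 = 0" for k l
        by (auto simp: cross3_nth algebra_simps)
      have "\<not> (cross3 a b $ 3 = 0 \<and> cross3 a c $ 3 = 0)" "\<not> (cross3 a b $ 3 = 0 \<and> cross3 a d $ 3 = 0)"
        "\<not> (cross3 a c $ 3 = 0 \<and> cross3 a d $ 3 = 0)"
        using no_three_parallel t tri by blast+
      moreover have "\<not> (cross3 a b $ 3 = 0 \<and> cross3 c d $ 3 = 0)"
        "\<not> (cross3 a c $ 3 = 0 \<and> cross3 b d $ 3 = 0)" "\<not> (cross3 a d $ 3 = 0 \<and> cross3 b c $ 3 = 0)"
        using ne unfolding exceptional_pair_iff by blast+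
      moreover have "\<not> (cross3 b c $ 3 = 0 \<and> cross3 b d $ 3 = 0)"
        using no_three_parallel t tri by blast
      ultimately show False
        using par[of a b c] par[of a b d] par[of a c d] par[of b c d] by auto
    qed
    thus ?i unfolding i using pl by (intro exI[of _ p] exI[of _ 1]) auto
  qed
qed

end

section \<open>Rhombi\<close>

lemma orthogonal_to_cross3:
  assumes "cross3 a b \<noteq> 0" "n \<bullet> cross3 a b = 0"
  obtains x y where "n = x *s a + y *s b"
proof -
  define P where "P = cross3 a b"
  have PP: "P \<bullet> P \<noteq> 0" using assms(1) by (simp add: P_def)
  have "triple a b P \<noteq> 0" using PP by (simp add: triple_def P_def)
  then obtain x y z where n: "n = x *s a + y *s b + z *s P"
    by (rule triple_basis[of a b P n])
  have "n \<bullet> P = z * (P \<bullet> P)"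
    unfolding n by (simp add: P_def inner3 cross3_nth algebra_simps)
  hence "z = 0" using assms(2) PP by (simp add: P_def)
  thus thesis using that[of x y] n by simp
qed

context noncircular_ellipse
begin

text \<open>All eigenvectors of the pair M, K, now with the infinite eigenvalue included, so that
  axes and the line at infinity can be treated alike.\<close>

definition degenerate_line :: "real ^ 3 \<Rightarrow> bool" where
  "degenerate_line n \<longleftrightarrow> n \<noteq> 0 \<and> (n$1 = 0 \<and> n$2 = 0 \<or> (\<exists>s. eigenline s n))"

text \<open>Two independent kernel vectors would leave rank at most one, hence a zero
  adjugate.\<close>

lemma eigenlines_parallel:
  assumes "eigenline s m" "eigenline s n"
  shows "cross3 m n = 0"
proof (rule ccontr)
  assume nz: "cross3 m n \<noteq> 0"
  define N P where "N = pencil M (- s)" and "P = cross3 m n"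
  have N: "N *v m = 0" "N *v n = 0" using assms by (auto simp: eigenline_def N_def)
  have "\<exists>k. N $ i = k *s P" for i
  proof -
    have "N $ i \<bullet> m = (N *v m) $ i" "N $ i \<bullet> n = (N *v n) $ i"
      by (simp_all add: inner3 matrix_vector_mult_def sum_3)
    hence "N $ i \<bullet> m = 0" "N $ i \<bullet> n = 0" using N by simp_all
    moreover have "cross3 P r = (r \<bullet> m) *s n - (r \<bullet> n) *s m" for r
      by (simp add: P_def vec_eq_iff forall_3 cross3_nth inner3 algebra_simps)
    ultimately have "cross3 P (N $ i) = 0" by simp
    thus ?thesis using cross3_eq_0_scale nz unfolding P_def by metis
  qed
  then obtain k where k: "\<And>i. N $ i = k i *s P" by metis
  have "adj3 N $ 1 $ 1 = adj3 N $ 2 $ 2" "adj3 N $ 1 $ 2 = 0"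
    by (simp_all add: adj3_def k)
  thus False using adj3_pencil_nonzero[of "- s"] by (simp add: N_def)
qed

text \<open>Eigenvectors for different eigenvalues are orthogonal for both forms; K annihilates the
  line at infinity, which settles the infinite eigenvalue.\<close>

lemma degenerate_lines_orthogonal:
  assumes "degenerate_line m" "degenerate_line n" "cross3 m n \<noteq> 0"
  shows "bform M m n = 0 \<and> kdot m n = 0"
proof -
  have inf: "bform M m n = 0 \<and> kdot m n = 0"
    if deg: "degenerate_line n" and "cross3 m n \<noteq> 0" "m$1 = 0" "m$2 = 0" for m n
  proof -
    have k: "kdot m n = 0" using that by (simp add: kdot_def)
    have "\<not> (n$1 = 0 \<and> n$2 = 0)" using that by (auto simp: vec_eq_iff forall_3 cross3_nth)
    then obtain s where "eigenline s n" using deg unfolding degenerate_line_def by blast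
    thus ?thesis using eigenline_bform k by simp
  qed
  show ?thesis
  proof (cases "m$1 = 0 \<and> m$2 = 0 \<or> n$1 = 0 \<and> n$2 = 0")
    case True
    thus ?thesis
    proof
      assume "m$1 = 0 \<and> m$2 = 0"
      thus ?thesis using inf[OF assms(2,3)] by blast
    next
      assume "n$1 = 0 \<and> n$2 = 0"
      moreover have "cross3 n m \<noteq> 0" using assms(3) cross_skew[of n m] by simp
      ultimately have "bform M n m = 0 \<and> kdot n m = 0" using inf[OF assms(1)] by blast
      thus ?thesis unfolding bform_M_sym[of m n] kdot_sym[of m n] .
    qed
  next
    case False
    then obtain s s' where s: "eigenline s m" "eigenline s' n"
      using assms(1,2) unfolding degenerate_line_def by blast
    have "s' \<noteq> s"
    proof
      assume "s' = s"
      hence "cross3 m n = 0" using eigenlines_parallel[of s m n] s by simp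
      thus False using assms(3) by simp
    qed
    moreover have "s' * kdot m n = s * kdot m n"
    proof -
      have "s' * kdot m n = bform M m n" by (rule eigenline_bform[OF s(2), symmetric])
      also have "\<dots> = bform M n m" by (rule bform_M_sym)
      also have "\<dots> = s * kdot n m" by (rule eigenline_bform[OF s(1)])
      also have "\<dots> = s * kdot m n" by (simp only: kdot_sym[of n m])
      finally show ?thesis .
    qed
    ultimately have "kdot m n = 0" by simp
    thus ?thesis using eigenline_bform[OF s(2), of m] by simp
  qed
qed

text \<open>Tangents that meet on an axis are mirror images in it, so with normals of equal length
  their difference represents the axis. For parallel tangents the difference is the line at
  infinity.\<close>

lemma exceptional_pair_reflection:
  assumes t: "tangent_to a X" "tangent_to b X" and c: "cross3 a b \<noteq> 0"
    and ex: "exceptional_pair X (cross3 a b) Q"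
  obtains k where "k \<noteq> 0" "k\<^sup>2 * kdot b b = kdot a a" "degenerate_line (a - k *s b)"
proof -
  have nz: "a - k *s b \<noteq> 0" for k
  proof
    assume "a - k *s b = 0"
    hence "cross3 a b = 0" by (simp add: vec_eq_iff forall_3 cross3_nth)
    thus False using c by simp
  qed
  have kp: "kdot a a > 0" "kdot b b > 0" using t tangent_kdot_pos by auto
  from ex show thesis unfolding exceptional_pair_iff
  proof (elim disjE conjE exE)
    assume "cross3 a b $ 3 = 0"
    hence p: "a$1 * b$2 = a$2 * b$1" by (simp add: cross3_nth)
    have b: "b$1 \<noteq> 0 \<or> b$2 \<noteq> 0" using kp(2) by (auto simp: kdot_def)
    obtain k where k: "a$1 = k * b$1" "a$2 = k * b$2"
    proof (cases "b$1 = 0")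
      case True
      with that[of "a$2 / b$2"] p b show thesis by simp
    next
      case False
      with that[of "a$1 / b$1"] p show thesis by (simp add: field_simps)
    qed
    have "kdot a a = k\<^sup>2 * kdot b b"
      by (simp add: kdot_def k power2_eq_square algebra_simps)
    moreover from this have "k \<noteq> 0" using kp(1) by auto
    moreover have "degenerate_line (a - k *s b)"
      using nz k by (simp add: degenerate_line_def)
    ultimately show thesis using that by simp
  next
    fix s n assume e: "eigenline s n" and P: "n \<bullet> cross3 a b = 0"
    obtain x y where n: "n = x *s a + y *s b"
      by (rule orthogonal_to_cross3[OF c P])
    have s: "s \<noteq> 0"
    proof
      assume "s = 0"
      moreover have "pencil M 0 = M" by (simp add: vec_eq_iff forall_3)
      ultimately show False using e M_inj by (auto simp: eigenline_def)
    qed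
    \<comment> \<open>The eigenvalue equation tested on \<open>a\<close> and on \<open>b\<close>;
      eliminating M(a, b) leaves the comparison of the lengths.\<close>
    have "y * bform M a b = s * (x * kdot a a + y * kdot a b)"
      "x * bform M a b = s * (x * kdot a b + y * kdot b b)"
      using eigenline_bform[OF e, of a] eigenline_bform[OF e, of b] t bform_M_sym[of b a]
        kdot_sym[of b a] unfolding n by (simp_all add: bform_linear kdot_linear tangent_iff)
    hence "s * (x\<^sup>2 * kdot a a - y\<^sup>2 * kdot b b) = 0" by algebra
    hence sq: "x\<^sup>2 * kdot a a = y\<^sup>2 * kdot b b" using s by simp
    have "n \<noteq> 0" using e by (simp add: eigenline_def)
    hence x: "x \<noteq> 0" using sq kp(2) by (auto simp: n)
    hence y: "y \<noteq> 0" using sq kp(1) by auto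
    have "a - (- y / x) *s b = (1 / x) *s n"
      using x by (simp add: n vec_eq_iff add_divide_distrib)
    moreover have "eigenline s ((1 / x) *s n)"
      using e x by (simp add: eigenline_def vector_scalar_commute)
    ultimately have "degenerate_line (a - (- y / x) *s b)"
      using nz unfolding degenerate_line_def by metis
    moreover have "(- y / x)\<^sup>2 * kdot b b = kdot a a" using sq x by (simp add: field_simps)
    ultimately show thesis using that[of "- y / x"] x y by simp
  qed
qed

text \<open>The three differences are an M-orthogonal basis, because each has M-square -2 times a
  nonzero M(a, l). A vector orthogonal to all of them vanishes.\<close>

lemma rhombus_relation:
  assumes t: "tangent_to a X" "tangent_to b X" "tangent_to c X" "tangent_to d X"
    and c: "cross3 a b \<noteq> 0" "cross3 a c \<noteq> 0" "cross3 a d \<noteq> 0"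
      "cross3 b c \<noteq> 0" "cross3 b d \<noteq> 0" "cross3 c d \<noteq> 0"
    and deg: "degenerate_line (a - b)" "degenerate_line (a - c)" "degenerate_line (a - d)"
  shows "a = b + c + d"
    and "\<exists>l\<in>{b, c, d}. a$1 = l$1 \<and> a$2 = l$2"
proof -
  have tri: "triple a b c \<noteq> 0" "triple a b d \<noteq> 0" "triple a c d \<noteq> 0" "triple b c d \<noteq> 0"
    using tangents_triple[OF t(1,2,3) c(1,2,4)] tangents_triple[OF t(1,2,4) c(1,3,5)]
      tangents_triple[OF t(1,3,4) c(2,3,6)] tangents_triple[OF t(2,3,4) c(4,5,6)] by simp_all
  have cr: "cross3 (a - k) (a - l) \<noteq> 0" if "triple a k l \<noteq> 0" for k l
  proof
    assume "cross3 (a - k) (a - l) = 0"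
    moreover have "cross3 (a - k) (a - l) \<bullet> a = triple a k l"
      by (simp add: triple_coords inner3 cross3_nth algebra_simps)
    ultimately show False using that by simp
  qed
  have orth: "bform M (a - b) (a - c) = 0" "bform M (a - b) (a - d) = 0" "bform M (a - c) (a - d) = 0"
    and korth: "kdot (a - b) (a - c) = 0" "kdot (a - b) (a - d) = 0" "kdot (a - c) (a - d) = 0"
    using degenerate_lines_orthogonal deg cr tri by simp_all
  have orth': "bform M (a - c) (a - b) = 0" "bform M (a - d) (a - b) = 0" "bform M (a - d) (a - c) = 0"
    using orth bform_M_sym by simp_all
  have tt: "bform M a a = 0" "bform M b b = 0" "bform M c c = 0" "bform M d d = 0"
    using t by (auto simp: tangent_iff)
  have own: "bform M (a - b) (a - b) \<noteq> 0" "bform M (a - c) (a - c) \<noteq> 0" "bform M (a - d) (a - d) \<noteq> 0"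
    using tangents_conjugate[OF t(1,2) c(1)] tangents_conjugate[OF t(1,3) c(2)]
      tangents_conjugate[OF t(1,4) c(3)] bform_M_sym[of b a] bform_M_sym[of c a] bform_M_sym[of d a]
    by (simp_all add: bform_linear tt)
  have ind: "x = 0 \<and> y = 0 \<and> z = 0"
    if "x *s (a - b) + y *s (a - c) + z *s (a - d) = 0" (is "?u = 0") for x y z
  proof -
    have "bform M (a - b) ?u = 0" "bform M (a - c) ?u = 0" "bform M (a - d) ?u = 0"
      unfolding that by (simp_all add: bform_def scalar_product_def)
    hence "x * bform M (a - b) (a - b) = 0" "y * bform M (a - c) (a - c) = 0"
      "z * bform M (a - d) (a - d) = 0"
      unfolding bform_add_right bform_scale_right orth orth' by simp_all
    thus ?thesis using own by simp
  qed
  have tri': "triple (a - b) (a - c) (a - d) \<noteq> 0"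
  proof
    assume 0: "triple (a - b) (a - c) (a - d) = 0"
    define m where "m = cross3 (a - c) (a - d)"
    have "triple m (a - c) (a - d) *s (a - b) + triple (a - b) m (a - d) *s (a - c)
        + triple (a - b) (a - c) m *s (a - d) = 0"
      using cramer_span[of "a - b" "a - c" "a - d" m] 0 by simp
    from ind[OF this] have "triple m (a - c) (a - d) = 0" by simp
    moreover have "triple m (a - c) (a - d) = m \<bullet> m"
      by (simp add: m_def triple_coords inner3 cross3_nth algebra_simps)
    ultimately show False using cr[OF tri(3)] by (simp add: m_def)
  qed
  define v where "v = a - b - c - d"
  \<comment> \<open>For the first: \<open>v\<close> is (a - c) + (a - d) - (a + b), and a - b is
    conjugate to each bracket, to the last one since M(a, a) = M(b, b) = 0.\<close>
  have v0: "bform M (a - b) v = 0" "bform M (a - c) v = 0" "bform M (a - d) v = 0"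
    using orth tt bform_M_sym[of b a] bform_M_sym[of c a] bform_M_sym[of d a]
      bform_M_sym[of c b] bform_M_sym[of d b] bform_M_sym[of d c]
    by (simp_all add: v_def bform_linear)
  have "bform M w v = 0" for w
  proof -
    obtain x y z where "w = x *s (a - b) + y *s (a - c) + z *s (a - d)"
      by (rule triple_basis[OF tri', of w])
    thus ?thesis using v0 by (simp only: bform_add_left bform_scale_left)
  qed
  hence "bform M (axis i 1) v = 0" for i by simp
  hence "(M *v v) $ i = 0" for i
    by (simp add: bform_def scalar_product_def axis_def if_distrib if_distribR cong: if_cong)
  hence "M *v v = 0" by (simp add: vec_eq_iff)
  hence "v = 0" by (rule M_inj)
  thus "a = b + c + d" by (simp add: v_def algebra_simps)
  show "\<exists>l\<in>{b, c, d}. a$1 = l$1 \<and> a$2 = l$2"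
  proof -
    \<comment> \<open>Of three pairwise orthogonal vectors of the plane one is zero: one of the
      differences is the line at infinity.\<close>
    have plane: "x1 = 0 \<and> x2 = 0 \<or> y1 = 0 \<and> y2 = 0 \<or> z1 = 0 \<and> z2 = 0"
      if "x1 * y1 + x2 * y2 = 0" "x1 * z1 + x2 * z2 = 0" "y1 * z1 + y2 * z2 = 0"
      for x1 x2 y1 y2 z1 z2 :: real
    proof -
      have "(x1 * y2 - x2 * y1) * (z1\<^sup>2 + z2\<^sup>2) =
          (x1 * z1 + x2 * z2) * (z1 * y2 - z2 * y1) - (z1 * x2 - z2 * x1) * (y1 * z1 + y2 * z2)"
        by (simp add: power2_eq_square algebra_simps)
      also have "\<dots> = 0" using that by simp
      finally have e: "(x1 * y2 - x2 * y1) * (z1\<^sup>2 + z2\<^sup>2) = 0" .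
      have "(x1\<^sup>2 + x2\<^sup>2) * (y1\<^sup>2 + y2\<^sup>2) = (x1 * y1 + x2 * y2)\<^sup>2 + (x1 * y2 - x2 * y1)\<^sup>2"
        by (simp add: power2_eq_square algebra_simps)
      hence "(x1\<^sup>2 + x2\<^sup>2) * (y1\<^sup>2 + y2\<^sup>2) = (x1 * y2 - x2 * y1)\<^sup>2"
        using that(1) by simp
      hence "(x1\<^sup>2 + x2\<^sup>2) * ((y1\<^sup>2 + y2\<^sup>2) * (z1\<^sup>2 + z2\<^sup>2)) =
          (x1 * y2 - x2 * y1) * ((x1 * y2 - x2 * y1) * (z1\<^sup>2 + z2\<^sup>2))"
        by (simp only: mult.assoc[symmetric] power2_eq_square)
      hence "(x1\<^sup>2 + x2\<^sup>2) * ((y1\<^sup>2 + y2\<^sup>2) * (z1\<^sup>2 + z2\<^sup>2)) = 0"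
        unfolding e by simp
      thus ?thesis unfolding mult_eq_0_iff sum_power2_eq_zero_iff by blast
    qed
    have "a$1 - b$1 = 0 \<and> a$2 - b$2 = 0 \<or> a$1 - c$1 = 0 \<and> a$2 - c$2 = 0 \<or>
        a$1 - d$1 = 0 \<and> a$2 - d$2 = 0"
      using korth by (intro plane) (simp_all add: kdot_def)
    thus ?thesis by auto
  qed
qed

text \<open>As \<open>a\<close> and \<open>d\<close> have the same normal, \<open>b\<close> and
  \<open>c\<close> have opposite ones. Both strips have the same width, and the circle inscribed in
  both touches all four lines.\<close>

lemma rhombus_circle:
  assumes t: "tangent_to a X" "tangent_to b X" "tangent_to c X" "tangent_to d X"
    and tri: "triple a b d \<noteq> 0"
    and k: "kdot b b = kdot a a" "kdot c c = kdot a a" "kdot d d = kdot a a"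
    and sum: "a = b + c + d" and par: "a$1 = d$1" "a$2 = d$2"
  shows "\<exists>p q. p$3 \<noteq> 0 \<and> q \<noteq> 0 \<and> (\<forall>l\<in>{a, b, c, d}. (p \<bullet> l)\<^sup>2 = q\<^sup>2 * kdot l l)"
proof -
  define z where "z = a$3 - d$3"
  have z: "z \<noteq> 0"
  proof
    assume "z = 0"
    hence "a = d" using par by (simp add: z_def vec_eq_iff forall_3)
    thus False using tri by (simp add: triple_coords algebra_simps)
  qed
  have c': "c = a - b - d" using sum by simp
  \<comment> \<open>The centre is the meet of the midlines \<open>a + d\<close> and
    \<open>b - c\<close> of the two strips.\<close>
  define p where "p = cross3 (a + d) (b - c)"
  have pz: "p \<bullet> a = p$3 * z / 2" "p \<bullet> d = - (p$3 * z / 2)" "p \<bullet> b = p$3 * z / 2" "p \<bullet> c = p$3 * z / 2"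
    by (simp_all add: p_def inner3 cross3_nth c' z_def par field_simps)
  have "triple a b d = - z * cross3 a b $ 3"
    by (simp add: triple_coords cross3_nth z_def par[symmetric] algebra_simps)
  moreover have "p$3 = 4 * cross3 a b $ 3"
    by (simp add: p_def cross3_nth c' par[symmetric] algebra_simps)
  ultimately have p3: "p$3 \<noteq> 0" using tri by auto
  have r: "kdot a a > 0" using tangent_kdot_pos[OF t(1)] .
  define q where "q = p$3 * z / (2 * sqrt (kdot a a))"
  have "q\<^sup>2 * kdot a a = (p$3 * z / 2)\<^sup>2"
    using r by (simp add: q_def power_divide power_mult_distrib)
  moreover have "q \<noteq> 0" using r z p3 by (simp add: q_def)
  ultimately show ?thesis
    using p3 by (intro exI[of _ p] exI[of _ q]) (simp add: pz k)
qed

text \<open>Squaring \<open>a - b = c + d\<close> in M and in K shows that the values at (c, d) are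
  the negatives of those at (a, b), so one parameter serves both points.\<close>

lemma rhombus_confocal:
  assumes t: "tangent_to a X" "tangent_to b X" "tangent_to c X" "tangent_to d X"
    and c: "cross3 a b \<noteq> 0" "cross3 c d \<noteq> 0"
    and tri: "triple a b c \<noteq> 0"
    and k: "kdot b b = kdot a a" "kdot c c = kdot a a" "kdot d d = kdot a a"
    and sum: "a = b + c + d"
  shows "\<exists>t. det (pencil M t) \<noteq> 0 \<and> bform (adj3 (pencil M t)) (cross3 a b) (cross3 a b) = 0 \<and>
    bform (adj3 (pencil M t)) (cross3 c d) (cross3 c d) = 0"
proof -
  have r: "kdot a a > 0" using tangent_kdot_pos[OF t(1)] .
  have m: "bform M a b \<noteq> 0" using tangents_conjugate[OF t(1,2) c(1)] .
  have k0: "v$1 = 0 \<and> v$2 = 0" if "kdot v v = 0" for v :: "real^3"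
    using that by (simp add: kdot_def sum_squares_eq_zero_iff)
  have tt: "bform M a a = 0" "bform M b b = 0" "bform M c c = 0" "bform M d d = 0"
    using t by (auto simp: tangent_iff)
  have e: "a - b = c + d" using sum by simp
  have "bform M (a - b) (a - b) = bform M (c + d) (c + d)" unfolding e ..
  hence mcd: "bform M c d = - bform M a b"
    using bform_M_sym[of b a] bform_M_sym[of d c] by (simp add: bform_linear tt)
  have "kdot (a - b) (a - b) = kdot (c + d) (c + d)" unfolding e ..
  hence kcd: "kdot c d = - kdot a b"
    using kdot_sym[of b a] kdot_sym[of d c] by (simp add: kdot_linear k)
  \<comment> \<open>Otherwise \<open>a\<close> and \<open>b\<close> have opposite normals,
    \<open>c\<close> and \<open>d\<close> equal ones, and the relation makes all four lines
    parallel.\<close>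
  have nz: "kdot a a + kdot a b \<noteq> 0"
  proof
    assume 0: "kdot a a + kdot a b = 0"
    have "kdot (a + b) (a + b) = 0" "kdot (c - d) (c - d) = 0"
      using 0 kcd kdot_sym[of b a] kdot_sym[of d c] by (simp_all add: kdot_linear k)
    hence "a$1 + b$1 = 0" "a$2 + b$2 = 0" "c$1 = d$1" "c$2 = d$2"
      using k0[of "a + b"] k0[of "c - d"] by simp_all
    hence "b$1 = - a$1" "b$2 = - a$2" "c$1 = a$1" "c$2 = a$2"
      using sum by (simp_all add: vec_eq_iff forall_3)
    hence "triple a b c = 0" by (simp add: triple_coords algebra_simps)
    thus False using tri by simp
  qed
  \<comment> \<open>The condition for the meet of \<open>a\<close> and \<open>b\<close> allows
    either sign of \<open>s * kdot a a\<close>; the negative sign is chosen.\<close>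
  define s where "s = - bform M a b / (kdot a a + kdot a b)"
  have s: "bform M a b + s * kdot a b = - s * kdot a a"
    using nz by (simp add: s_def field_simps)
  have s': "bform M c d + s * kdot c d = s * kdot a a"
    using s by (simp add: mcd kcd)
  have on: "bform (adj3 (pencil M s)) (cross3 a b) (cross3 a b) = 0"
    "bform (adj3 (pencil M s)) (cross3 c d) (cross3 c d) = 0"
    unfolding pencil_through_meet[OF t(1,2)] pencil_through_meet[OF t(3,4)] s s'
    by (simp_all add: k power2_eq_square)
  moreover have "det (pencil M s) \<noteq> 0"
  proof
    assume "det (pencil M s) = 0"
    then obtain n where n: "eigenline (- s) n" "n \<bullet> cross3 a b = 0" "n \<bullet> cross3 c d = 0"
      using singular_pencil_kernel on by blast
    obtain x y where xy: "n = x *s a + y *s b"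
      by (rule orthogonal_to_cross3[OF c(1) n(2)])
    have "n \<bullet> cross3 c d = (x + y) * triple a b c"
    proof -
      have d: "d = a - b - c" using sum by simp
      show ?thesis
        unfolding xy d by (simp add: inner3 cross3_nth triple_coords algebra_simps)
    qed
    hence y: "y = - x" using n(3) tri by simp
    have "x * (- bform M a b) = - s * (x * (kdot a a - kdot a b))"
      using eigenline_bform[OF n(1), of a] unfolding xy y
      by (simp add: bform_linear kdot_linear tt algebra_simps)
    moreover have "x \<noteq> 0" using n(1) xy y by (auto simp: eigenline_def)
    ultimately have "bform M a b = s * (kdot a a - kdot a b)" by simp
    hence "s * kdot a a = 0" using s by (simp add: algebra_simps)
    thus False using s m r by simp
  qed
  ultimately show ?thesis by blast
qed

lemma tangent_scale: "k \<noteq> 0 \<Longrightarrow> tangent_to l X \<Longrightarrow> tangent_to (k *s l) X"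
  by (simp add: tangent_iff bform_linear)

text \<open>The three vertices on \<open>a\<close> lie on degenerate lines. The hypotheses treat
  \<open>b\<close>, \<open>c\<close>, \<open>d\<close> alike, so permuting these yields the conics
  for the other two pairs.\<close>

lemma exceptional_circle_confocal:
  assumes t: "tangent_to a X" "tangent_to b X" "tangent_to c X" "tangent_to d X"
    and c: "cross3 a b \<noteq> 0" "cross3 a c \<noteq> 0" "cross3 a d \<noteq> 0"
      "cross3 b c \<noteq> 0" "cross3 b d \<noteq> 0" "cross3 c d \<noteq> 0"
    and ex: "exceptional_pair X (cross3 a b) Q" "exceptional_pair X (cross3 a c) T"
      "exceptional_pair X (cross3 a d) V"
  shows "(\<exists>C. circle C \<and> (\<forall>l\<in>{a, b, c, d}. tangent_to l C))"
    and "(\<exists>R. real_conic R \<and> confocal R X \<and> on_conic R (cross3 a b) \<and> on_conic R (cross3 c d))"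
proof -
  obtain x where x: "x \<noteq> 0" "x\<^sup>2 * kdot b b = kdot a a" "degenerate_line (a - x *s b)"
    by (rule exceptional_pair_reflection[OF t(1,2) c(1) ex(1)])
  obtain y where y: "y \<noteq> 0" "y\<^sup>2 * kdot c c = kdot a a" "degenerate_line (a - y *s c)"
    by (rule exceptional_pair_reflection[OF t(1,3) c(2) ex(2)])
  obtain z where z: "z \<noteq> 0" "z\<^sup>2 * kdot d d = kdot a a" "degenerate_line (a - z *s d)"
    by (rule exceptional_pair_reflection[OF t(1,4) c(3) ex(3)])
  \<comment> \<open>Scaled such that all four normals have the same length and \<open>a\<close>
    minus each of the others is a degenerate line.\<close>
  define b' c' d' where "b' = x *s b" and "c' = y *s c" and "d' = z *s d"
  have t': "tangent_to a X" "tangent_to b' X" "tangent_to c' X" "tangent_to d' X"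
    using t x y z tangent_scale by (auto simp: b'_def c'_def d'_def)
  have c': "cross3 a b' \<noteq> 0" "cross3 a c' \<noteq> 0" "cross3 a d' \<noteq> 0"
      "cross3 b' c' \<noteq> 0" "cross3 b' d' \<noteq> 0" "cross3 c' d' \<noteq> 0"
    using c x y z cross3_scale[of 1 a] by (auto simp: b'_def c'_def d'_def cross3_scale)
  have k: "kdot b' b' = kdot a a" "kdot c' c' = kdot a a" "kdot d' d' = kdot a a"
    using x y z by (simp_all add: b'_def c'_def d'_def kdot_linear power2_eq_square)
  note tri = tangents_triple[OF t'(1-3) c'(1,2,4)] tangents_triple[OF t'(1,2,4) c'(1,3,5)]
    tangents_triple[OF t'(1,3,4) c'(2,3,6)]
  have tri': "triple a d' b' \<noteq> 0" "triple a d' c' \<noteq> 0" "triple a c' b' \<noteq> 0"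
    using tri by (auto simp: triple_coords algebra_simps)
  have rel: "a = b' + c' + d'" "\<exists>l\<in>{b', c', d'}. a$1 = l$1 \<and> a$2 = l$2"
    using rhombus_relation[OF t' c'] x y z by (simp_all add: b'_def c'_def d'_def)
  \<comment> \<open>Whichever of the three lines is parallel to \<open>a\<close> takes the role of
    the last tangent in \<open>rhombus_circle\<close>.\<close>
  from rel(2) have "\<exists>p q. p$3 \<noteq> 0 \<and> q \<noteq> 0 \<and> (\<forall>l\<in>{a, b', c', d'}. (p \<bullet> l)\<^sup>2 = q\<^sup>2 * kdot l l)"
  proof (elim bexE insertE emptyE conjE; hypsubst)
    assume par: "a$1 = b'$1" "a$2 = b'$2"
    have "\<exists>p q. p$3 \<noteq> 0 \<and> q \<noteq> 0 \<and> (\<forall>l\<in>{a, c', d', b'}. (p \<bullet> l)\<^sup>2 = q\<^sup>2 * kdot l l)"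
      by (rule rhombus_circle[OF t'(1,3,4,2) tri'(3) k(2,3,1) _ par]) (simp add: rel(1))
    thus ?thesis by (simp only: insert_commute)
  next
    assume par: "a$1 = c'$1" "a$2 = c'$2"
    have "\<exists>p q. p$3 \<noteq> 0 \<and> q \<noteq> 0 \<and> (\<forall>l\<in>{a, b', d', c'}. (p \<bullet> l)\<^sup>2 = q\<^sup>2 * kdot l l)"
      by (rule rhombus_circle[OF t'(1,2,4,3) tri(1) k(1,3,2) _ par]) (simp add: rel(1))
    thus ?thesis by (simp only: insert_commute)
  next
    assume par: "a$1 = d'$1" "a$2 = d'$2"
    show ?thesis by (rule rhombus_circle[OF t' tri(2) k rel(1) par])
  qed
  then obtain p q where p: "p$3 \<noteq> 0" "q \<noteq> 0" "\<forall>l\<in>{a, b', c', d'}. (p \<bullet> l)\<^sup>2 = q\<^sup>2 * kdot l l"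
    by blast
  have sc: "(p \<bullet> l)\<^sup>2 = q\<^sup>2 * kdot l l" if "(p \<bullet> (k *s l))\<^sup>2 = q\<^sup>2 * kdot (k *s l) (k *s l)" "k \<noteq> 0" for k l
  proof -
    have "p \<bullet> (k *s l) = k * (p \<bullet> l)" by (simp add: inner3 algebra_simps)
    hence "k\<^sup>2 * (p \<bullet> l)\<^sup>2 = k\<^sup>2 * (q\<^sup>2 * kdot l l)"
      using that(1) by (simp add: kdot_linear power2_eq_square algebra_simps)
    thus ?thesis using that(2) by simp
  qed
  have "\<forall>l\<in>{a, b, c, d}. (p \<bullet> l)\<^sup>2 = q\<^sup>2 * kdot l l"
    using p(3) sc[OF _ x(1), of b] sc[OF _ y(1), of c] sc[OF _ z(1), of d]
    by (simp add: b'_def c'_def d'_def)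
  hence "\<exists>p q. p$3 \<noteq> 0 \<and> q \<noteq> 0 \<and> (\<forall>l\<in>{a, b, c, d}. (p \<bullet> l)\<^sup>2 = q\<^sup>2 * kdot l l)"
    using p(1,2) by (intro exI[of _ p] exI[of _ q]) simp
  moreover have "l \<noteq> 0" if "l \<in> {a, b, c, d}" for l
    using t that by (auto simp: tangent_iff)
  ultimately show "\<exists>C. circle C \<and> (\<forall>l\<in>{a, b, c, d}. tangent_to l C)"
    by (subst circle_tangents_iff) simp_all
  have cr: "cross3 a b' = x *s cross3 a b" "cross3 c' d' = (y * z) *s cross3 c d"
    using cross3_scale[of 1 a x b] by (simp_all add: b'_def c'_def d'_def cross3_scale)
  obtain s where s: "det (pencil M s) \<noteq> 0" "bform (adj3 (pencil M s)) (cross3 a b') (cross3 a b') = 0"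
      "bform (adj3 (pencil M s)) (cross3 c' d') (cross3 c' d') = 0"
    using rhombus_confocal[OF t' c'(1,6) tri(1) k rel(1)] by blast
  have "bform (adj3 (pencil M s)) (cross3 a b) (cross3 a b) = 0"
      "bform (adj3 (pencil M s)) (cross3 c d) (cross3 c d) = 0"
    using s(2,3) x(1) y(1) z(1) unfolding cr bform_scale_left bform_scale_right by simp_all
  thus "\<exists>R. real_conic R \<and> confocal R X \<and> on_conic R (cross3 a b) \<and> on_conic R (cross3 c d)"
    unfolding confocal_through_iff[OF ellipse not_circle c(1,6)] using s(1) by blast
qed

end

section \<open>The equivalences for the three pairs, obtained by permuting the tangents\<close>

theorem theorem3:
  fixes X :: "real ^ 3 ^ 3" and a b c d P Q S T U V :: "real ^ 3"
  assumes "ellipse X" and "\<not> circle X"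
    and "tangent_to a X" and "tangent_to b X" and "tangent_to c X" and "tangent_to d X"
    and "distinct [span {a}, span {b}, span {c}, span {d}]"
    and "P = cross3 a b" and "Q = cross3 c d"
    and "S = cross3 a c" and "T = cross3 b d"
    and "U = cross3 b c" and "V = cross3 a d"
    and "exceptional_pair X P Q \<longleftrightarrow> exceptional_pair X S T"
    and "exceptional_pair X S T \<longleftrightarrow> exceptional_pair X U V"
  shows "((\<exists>C. circle C \<and> tangent_to a C \<and> tangent_to b C \<and> tangent_to c C \<and> tangent_to d C) \<longleftrightarrow>
            (\<exists>R. real_conic R \<and> confocal R X \<and> on_conic R P \<and> on_conic R Q)) \<and>
         ((\<exists>R. real_conic R \<and> confocal R X \<and> on_conic R P \<and> on_conic R Q) \<longleftrightarrow>
            (\<exists>G. real_conic G \<and> confocal G X \<and> on_conic G S \<and> on_conic G T)) \<and>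
         ((\<exists>G. real_conic G \<and> confocal G X \<and> on_conic G S \<and> on_conic G T) \<longleftrightarrow>
            (\<exists>B. real_conic B \<and> confocal B X \<and> on_conic B U \<and> on_conic B V))"
proof -
  interpret noncircular_ellipse X by unfold_locales fact+
  note t = assms(3-6)
  have cr: "cross3 k l \<noteq> 0" if "tangent_to k X" "tangent_to l X" "span {k} \<noteq> span {l}" for k l
  proof
    assume "cross3 k l = 0"
    moreover have k0: "k \<noteq> 0" "l \<noteq> 0" using that by (auto simp: tangent_iff)
    ultimately obtain x where x: "l = x *s k" using cross3_eq_0_scale by blast
    hence "x \<noteq> 0" using k0 by auto
    hence l: "l = x *\<^sub>R k" and k: "k = (1 / x) *\<^sub>R l" by (simp_all add: x vec_eq_iff)
    have "x *\<^sub>R k \<in> span {k}" "(1 / x) *\<^sub>R l \<in> span {l}"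
      by (intro span_scale span_base; simp)+
    hence "l \<in> span {k}" "k \<in> span {l}"
      unfolding l[symmetric] k[symmetric] .
    hence "span {k} = span {l}" unfolding span_eq by simp
    thus False using that by simp
  qed
  have sp: "span {a} \<noteq> span {b}" "span {a} \<noteq> span {c}" "span {a} \<noteq> span {d}"
    "span {b} \<noteq> span {c}" "span {b} \<noteq> span {d}" "span {c} \<noteq> span {d}"
    using assms(7) unfolding distinct.simps list.set insert_iff empty_iff by blast+
  have c: "cross3 a b \<noteq> 0" "cross3 a c \<noteq> 0" "cross3 a d \<noteq> 0"
    "cross3 b c \<noteq> 0" "cross3 b d \<noteq> 0" "cross3 c d \<noteq> 0"
    "cross3 c b \<noteq> 0" "cross3 d b \<noteq> 0" "cross3 d c \<noteq> 0"
    using cr[OF t(1,2) sp(1)] cr[OF t(1,3) sp(2)] cr[OF t(1,4) sp(3)] cr[OF t(2,3) sp(4)]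
      cr[OF t(2,4) sp(5)] cr[OF t(3,4) sp(6)] cr[OF t(3,2) sp(4)[symmetric]]
      cr[OF t(4,2) sp(5)[symmetric]] cr[OF t(4,3) sp(6)[symmetric]] by blast+
  have neg: "cross3 c b = - cross3 b c" "cross3 d b = - cross3 b d" "cross3 d c = - cross3 c d"
    by (simp_all add: cross_skew[of c b] cross_skew[of d b] cross_skew[of d c])
  have comm: "exceptional_pair X K L \<longleftrightarrow> exceptional_pair X L K"
    and minus: "exceptional_pair X K (- L) \<longleftrightarrow> exceptional_pair X K L" for K L
    unfolding exceptional_pair_iff by auto
  let ?i = "\<exists>C. circle C \<and> (\<forall>l\<in>{a, b, c, d}. tangent_to l C)"
  let ?on = "\<lambda>K L. \<exists>R. real_conic R \<and> confocal R X \<and> on_conic R K \<and> on_conic R L"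
  have swap: "{a, c, b, d} = {a, b, c, d}" "{a, d, b, c} = {a, b, c, d}" by auto
  \<comment> \<open>Each conic is compared with the circle, whose condition is symmetric in the four
    lines. By hypothesis either all three pairs are exceptional or none is; the last pair is
    reversed to start with a vertex on \<open>a\<close>.\<close>
  have main: "(?i \<longleftrightarrow> ?on P Q) \<and> (?i \<longleftrightarrow> ?on S T) \<and> (?i \<longleftrightarrow> ?on V U)"
  proof (cases "exceptional_pair X P Q")
    case True
    hence ex: "exceptional_pair X (cross3 a b) Q" "exceptional_pair X (cross3 a c) T"
        "exceptional_pair X (cross3 a d) U"
      using assms(8-15) comm by auto
    have "?i"
      by (rule exceptional_circle_confocal(1)[OF t c(1-6) ex])
    moreover have "?on P Q"
      unfolding assms(8,9) by (rule exceptional_circle_confocal(2)[OF t c(1-6) ex])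
    moreover have "?on S T"
      unfolding assms(10,11)
      by (rule exceptional_circle_confocal(2)[OF t(1,3,2,4) c(2,1,3,7,6,5) ex(2,1,3)])
    moreover have "?on V U"
      unfolding assms(12,13)
      by (rule exceptional_circle_confocal(2)[OF t(1,4,2,3) c(3,1,2,8,9,4) ex(3,1,2)])
    ultimately show ?thesis by (simp only: simp_thms)
  next
    case False
    hence ne: "\<not> exceptional_pair X (cross3 a b) (cross3 c d)"
        "\<not> exceptional_pair X (cross3 a c) (cross3 b d)"
        "\<not> exceptional_pair X (cross3 a d) (cross3 b c)"
        "\<not> exceptional_pair X (cross3 a d) (cross3 c b)"
        "\<not> exceptional_pair X (cross3 a b) (cross3 d c)"
        "\<not> exceptional_pair X (cross3 a c) (cross3 d b)"
      using assms(8-15) comm unfolding neg minus by auto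
    show ?thesis
    proof (intro conjI)
      show "?i \<longleftrightarrow> ?on P Q"
        unfolding assms(8,9) by (rule circle_iff_confocal[OF t c(1-6) ne(1-3)])
      show "?i \<longleftrightarrow> ?on S T"
        unfolding assms(10,11)
        by (rule circle_iff_confocal[OF t(1,3,2,4) c(2,1,3,7,6,5) ne(2,1,4), unfolded swap])
      show "?i \<longleftrightarrow> ?on V U"
        unfolding assms(12,13)
        by (rule circle_iff_confocal[OF t(1,4,2,3) c(3,1,2,8,9,4) ne(3,5,6), unfolded swap])
    qed
  qed
  have UV: "?on V U \<longleftrightarrow> ?on U V" by (simp only: conj_commute conj_left_commute)
  have i: "?i \<longleftrightarrow> (\<exists>C. circle C \<and> tangent_to a C \<and> tangent_to b C \<and> tangent_to c C \<and> tangent_to d C)"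
    by simp
  note P = main[THEN conjunct1] and S = main[THEN conjunct2, THEN conjunct1]
    and V = main[THEN conjunct2, THEN conjunct2]
  from trans[OF i[symmetric] P] trans[OF P[symmetric] S] trans[OF S[symmetric] trans[OF V UV]]
  show ?thesis by (rule conjI[OF _ conjI])
qed

end
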